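(* Let $\mathcal{M}$ be a finite factor with a faithful normal trace $\tau$, and let $C\in\mathcal{M}$. The $C$-numerical radius $\omega_{C}$ is a norm on $\mathcal{M}$ if and only if both of the following hold: (1) $C$ is not a scalar multiple of $I$; and (2) $\tau(C)\neq 0$.
   Context: A von Neumann algebra $\mathcal{M}$ on a Hilbert space is a factor if $\mathcal{M}\cap\mathcal{M}'=\mathbb{C}I$, and is finite if it has a faithful normal tracial state; $\tau$ denotes this faithful normal tracial state. All factors are assumed to have separable predual. $\mathscr{U}(\mathcal{M})$ is the set of unitary operators in $\mathcal{M}$. For $A,C\in\mathcal{M}$, the $C$-numerical radius of $A$ is $$\omega_{C}(A)=\sup_{U\in\mathscr{U}(\mathcal{M})}|\tau(CUAU^{*})|.$$ For every $C\in\mathcal{M}$, $\omega_C$ is a seminorm on $\mathcal{M}$ that is weakly unitarily invariant, i.e. $\omega_C(UAU^* )=\omega_C(A)$ for all $A\in\mathcal{M}$ and $U\in\mathscr{U}(\mathcal{M})$.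
   Formalization: The factor M is additionally assumed not to be the one-dimensional factor CI; for M = CI and C = I the C-numerical radius is |A|, a norm, although C is a scalar multiple of I, so the claim as stated fails there. *)

theory Defs
  imports "HOL-Analysis.Analysis"
begin

class scaleC =
  fixes scaleC :: "complex \<Rightarrow> 'a \<Rightarrow> 'a"  (infixr "*\<^sub>C" 75)

text \<open>
  The real inner product of the superclass is required to be the real part of the complex one.
  So the superclass supplies positive definiteness and the norm
  \<open>norm x = sqrt (Re (cinner x x))\<close>.
  The complex inner product is linear in the first argument.
\<close>

class complex_hilbert_space = real_inner + complete_space + scaleC +
  fixes cinner :: "'a \<Rightarrow> 'a \<Rightarrow> complex"
  assumes scaleC_add_right: "a *\<^sub>C (x + y) = a *\<^sub>C x + a *\<^sub>C y"
    and scaleC_add_left: "(a + b) *\<^sub>C x = a *\<^sub>C x + b *\<^sub>C x"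
    and scaleC_scaleC: "a *\<^sub>C b *\<^sub>C x = (a * b) *\<^sub>C x"
    and scaleR_eq_scaleC: "scaleR r x = complex_of_real r *\<^sub>C x"
    and cinner_commute: "cinner x y = cnj (cinner y x)"
    and cinner_add_left: "cinner (x + y) z = cinner x z + cinner y z"
    and cinner_scaleC_left: "cinner (a *\<^sub>C x) y = a * cinner x y"
    and inner_eq_Re_cinner: "inner x y = Re (cinner x y)"

lemma norm_scaleC: "norm (a *\<^sub>C x) = cmod a * norm x"
  for x :: "'h::complex_hilbert_space"
proof -
  have "cinner (a *\<^sub>C x) (a *\<^sub>C x) = a * cnj (cinner (a *\<^sub>C x) x)"
    by (metis cinner_scaleC_left cinner_commute)
  also have "\<dots> = (a * cnj a) * cinner x x"
    by (metis cinner_scaleC_left cinner_commute complex_cnj_mult mult.assoc)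
  finally have "inner (a *\<^sub>C x) (a *\<^sub>C x) = (cmod a)\<^sup>2 * inner x x"
    by (simp add: inner_eq_Re_cinner complex_mult_cnj cmod_power2)
  then show ?thesis
    by (simp add: norm_eq_sqrt_inner real_sqrt_mult)
qed

lemma bounded_linear_scaleC_right:
  "bounded_linear (\<lambda>x :: 'h::complex_hilbert_space. a *\<^sub>C x)"
proof (rule bounded_linear_intro[where K = "cmod a"])
  fix x y :: 'h and r :: real
  show "a *\<^sub>C (x + y) = a *\<^sub>C x + a *\<^sub>C y" by (rule scaleC_add_right)
  show "a *\<^sub>C (r *\<^sub>R x) = r *\<^sub>R (a *\<^sub>C x)"
    by (simp add: scaleR_eq_scaleC scaleC_scaleC mult.commute)
  show "norm (a *\<^sub>C x) \<le> norm x * cmod a" by (simp add: norm_scaleC mult.commute)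
qed

instantiation blinfun :: (real_normed_vector, complex_hilbert_space) scaleC
begin

lift_definition scaleC_blinfun :: "complex \<Rightarrow> 'a \<Rightarrow>\<^sub>L 'b \<Rightarrow> 'a \<Rightarrow>\<^sub>L 'b"
  is "\<lambda>c f x. c *\<^sub>C f x"
  by (rule bounded_linear_compose[OF bounded_linear_scaleC_right])

instance ..

end

text \<open>
  Elements of \<open>'h \<Rightarrow>\<^sub>L 'h\<close> are only real-linear; the bounded operators on the
  complex Hilbert space are the following ones.
\<close>

definition bounded_operators :: "('h::complex_hilbert_space \<Rightarrow>\<^sub>L 'h) set" where
  "bounded_operators = {A. \<forall>c x. blinfun_apply A (c *\<^sub>C x) = c *\<^sub>C blinfun_apply A x}"

definition scalar_operators :: "('h::complex_hilbert_space \<Rightarrow>\<^sub>L 'h) set" where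
  "scalar_operators = range (\<lambda>c. c *\<^sub>C id_blinfun)"

definition adj :: "('h::complex_hilbert_space \<Rightarrow>\<^sub>L 'h) \<Rightarrow> ('h \<Rightarrow>\<^sub>L 'h)" where
  "adj A = (THE B. \<forall>x y. cinner (blinfun_apply A x) y = cinner x (blinfun_apply B y))"

definition commutant :: "('h::complex_hilbert_space \<Rightarrow>\<^sub>L 'h) set \<Rightarrow> ('h \<Rightarrow>\<^sub>L 'h) set" where
  "commutant S = {B \<in> bounded_operators. \<forall>A\<in>S. A o\<^sub>L B = B o\<^sub>L A}"

text \<open>The double commutant condition makes \<open>M\<close> a unital subalgebra.\<close>

definition von_neumann_algebra :: "('h::complex_hilbert_space \<Rightarrow>\<^sub>L 'h) set \<Rightarrow> bool" where
  "von_neumann_algebra M \<longleftrightarrow>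
     M \<subseteq> bounded_operators \<and> (\<forall>A\<in>M. adj A \<in> M) \<and> commutant (commutant M) = M"

definition factor :: "('h::complex_hilbert_space \<Rightarrow>\<^sub>L 'h) set \<Rightarrow> bool" where
  "factor M \<longleftrightarrow> von_neumann_algebra M \<and> M \<inter> commutant M = scalar_operators"

definition unitaries :: "('h::complex_hilbert_space \<Rightarrow>\<^sub>L 'h) set \<Rightarrow> ('h \<Rightarrow>\<^sub>L 'h) set" where
  "unitaries M = {U \<in> M. adj U o\<^sub>L U = id_blinfun \<and> U o\<^sub>L adj U = id_blinfun}"

definition vector_sequence_functional ::
  "(nat \<Rightarrow> 'h::complex_hilbert_space) \<Rightarrow> (nat \<Rightarrow> 'h) \<Rightarrow> ('h \<Rightarrow>\<^sub>L 'h) \<Rightarrow> complex" where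
  "vector_sequence_functional \<xi> \<eta> A = (\<Sum>n. cinner (blinfun_apply A (\<xi> n)) (\<eta> n))"

text \<open>
  The ultraweak (\<open>\<sigma>\<close>-weak) topology on the bounded operators: the coarsest one for which
  \<open>A \<mapsto> \<Sum>n. \<langle>A \<xi>\<^sub>n, \<eta>\<^sub>n\<rangle>\<close> is continuous for all square-summable
  sequences \<open>\<xi>\<close>, \<open>\<eta>\<close>.
\<close>

definition ultraweak_topology :: "('h::complex_hilbert_space \<Rightarrow>\<^sub>L 'h) topology" where
  "ultraweak_topology = topology_generated_by
     {{A \<in> bounded_operators. vector_sequence_functional \<xi> \<eta> A \<in> V} | \<xi> \<eta> V.
        summable (\<lambda>n. (norm (\<xi> n))\<^sup>2) \<and> summable (\<lambda>n. (norm (\<eta> n))\<^sup>2) \<and> open V}"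

text \<open>
  Functionals on \<open>M\<close> are total functions whose values outside \<open>M\<close> are irrelevant.
\<close>

definition linear_functional_on ::
  "('h::complex_hilbert_space \<Rightarrow>\<^sub>L 'h) set \<Rightarrow> (('h \<Rightarrow>\<^sub>L 'h) \<Rightarrow> complex) \<Rightarrow> bool" where
  "linear_functional_on M \<phi> \<longleftrightarrow>
     (\<forall>A\<in>M. \<forall>B\<in>M. \<phi> (A + B) = \<phi> A + \<phi> B) \<and> (\<forall>c. \<forall>A\<in>M. \<phi> (c *\<^sub>C A) = c * \<phi> A)"

text \<open>The predual consists of the normal, i.e. ultraweakly continuous, linear functionals.\<close>

definition predual ::
  "('h::complex_hilbert_space \<Rightarrow>\<^sub>L 'h) set \<Rightarrow> (('h \<Rightarrow>\<^sub>L 'h) \<Rightarrow> complex) set" where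
  "predual M = {\<phi>. linear_functional_on M \<phi> \<and>
     continuous_map (subtopology ultraweak_topology M) euclidean \<phi>}"

text \<open>Separability is with respect to the dual norm, the supremum over the unit ball of \<open>M\<close>.\<close>

definition separable_predual :: "('h::complex_hilbert_space \<Rightarrow>\<^sub>L 'h) set \<Rightarrow> bool" where
  "separable_predual M \<longleftrightarrow>
     (\<exists>D. countable D \<and> D \<subseteq> predual M \<and>
       (\<forall>\<phi>\<in>predual M. \<forall>\<epsilon>>0. \<exists>\<psi>\<in>D. \<forall>A\<in>M. norm A \<le> 1 \<longrightarrow> cmod (\<phi> A - \<psi> A) \<le> \<epsilon>))"

definition state_on ::
  "('h::complex_hilbert_space \<Rightarrow>\<^sub>L 'h) set \<Rightarrow> (('h \<Rightarrow>\<^sub>L 'h) \<Rightarrow> complex) \<Rightarrow> bool" where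
  "state_on M \<tau> \<longleftrightarrow> linear_functional_on M \<tau> \<and>
     (\<forall>A\<in>M. \<tau> (adj A o\<^sub>L A) \<in> \<real>\<^sub>\<ge>\<^sub>0) \<and> \<tau> id_blinfun = 1"

definition faithful_normal_tracial_state ::
  "('h::complex_hilbert_space \<Rightarrow>\<^sub>L 'h) set \<Rightarrow> (('h \<Rightarrow>\<^sub>L 'h) \<Rightarrow> complex) \<Rightarrow> bool" where
  "faithful_normal_tracial_state M \<tau> \<longleftrightarrow>
     state_on M \<tau> \<and>
     (\<forall>A\<in>M. \<tau> (adj A o\<^sub>L A) = 0 \<longrightarrow> A = 0) \<and>
     \<tau> \<in> predual M \<and>
     (\<forall>A\<in>M. \<forall>B\<in>M. \<tau> (A o\<^sub>L B) = \<tau> (B o\<^sub>L A))"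

definition finite_factor :: "('h::complex_hilbert_space \<Rightarrow>\<^sub>L 'h) set \<Rightarrow> bool" where
  "finite_factor M \<longleftrightarrow> factor M \<and> (\<exists>\<tau>. faithful_normal_tracial_state M \<tau>)"

definition C_numerical_radius ::
  "('h::complex_hilbert_space \<Rightarrow>\<^sub>L 'h) set \<Rightarrow> (('h \<Rightarrow>\<^sub>L 'h) \<Rightarrow> complex) \<Rightarrow>
    ('h \<Rightarrow>\<^sub>L 'h) \<Rightarrow> ('h \<Rightarrow>\<^sub>L 'h) \<Rightarrow> real" where
  "C_numerical_radius M \<tau> C A =
     (SUP U\<in>unitaries M. cmod (\<tau> (C o\<^sub>L U o\<^sub>L A o\<^sub>L adj U)))"

definition norm_on ::
  "('h::complex_hilbert_space \<Rightarrow>\<^sub>L 'h) set \<Rightarrow> (('h \<Rightarrow>\<^sub>L 'h) \<Rightarrow> real) \<Rightarrow> bool" where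
  "norm_on M N \<longleftrightarrow>
     (\<forall>A\<in>M. 0 \<le> N A) \<and>
     (\<forall>A\<in>M. N A = 0 \<longleftrightarrow> A = 0) \<and>
     (\<forall>c. \<forall>A\<in>M. N (c *\<^sub>C A) = cmod c * N A) \<and>
     (\<forall>A\<in>M. \<forall>B\<in>M. N (A + B) \<le> N A + N B)"

end

theory Submission
  imports Defs
begin

text \<open>
  That \<open>\<omega>\<^sub>C\<close> is a finite seminorm follows from the inequality
  \<open>\<bar>\<tau>(X Y)\<bar> \<le> 2 \<tau>(X\<^sup>* X) + 2 \<tau>(Y\<^sup>* Y)\<close>, whose right-hand side does not
  change when \<open>Y\<close> is conjugated by a unitary. So the question is when its null space
  \<open>N = {A. \<tau>(C U A U\<^sup>*) = 0 for all unitaries U}\<close> vanishes.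

  The two conditions are necessary: if \<open>C = c I\<close>, then \<open>N\<close> contains \<open>B - \<tau>(B) I\<close> for every
  \<open>B\<close>, which is not zero for a nonscalar \<open>B\<close>, and if \<open>\<tau>(C) = 0\<close>, then \<open>N\<close> contains \<open>I\<close>.

  Conversely, let \<open>A \<in> N\<close>. Conjugating by a one-parameter family of unitaries generated by a
  self-adjoint \<open>H\<close> and differentiating at the identity gives \<open>\<tau>(C [H, A]) = 0\<close>, hence
  \<open>\<tau>(C [X, A]) = 0\<close> for every \<open>X\<close>. The family used here is the Cayley transform
  \<open>U = (I + i s H) (I - i s H)\<^sup>-\<^sup>1\<close>. With \<open>T = i s H\<close> and \<open>R = (I - T)\<^sup>-\<^sup>1\<close> it satisfies the exact
  identity \<open>U A U\<^sup>* = A + 2 R [T, A] R\<^sup>*\<close> (lemma \<open>cayley_unitary\<close>), so the derivative becomes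
  the limit \<open>s \<rightarrow> 0\<close> of \<open>\<tau>(C R [H, A] R\<^sup>*)\<close>. As left multiplication by
  \<open>R\<close> or \<open>R\<^sup>*\<close> does not increase \<open>\<tau>(X\<^sup>* X)\<close>, the inequality above controls this limit
  (lemma \<open>trace_resolvent_limit\<close>).

  By invariance of \<open>N\<close> under conjugation, \<open>[X, A]\<close> lies in \<open>N\<close> again, and by traciality
  \<open>\<tau>(C [X, A]) = 0\<close> for all \<open>X\<close> means that \<open>C\<close> commutes with \<open>A\<close>. Applied to \<open>[X, A]\<close> in place of
  \<open>A\<close>, this shows \<open>[[X, A], C] = 0\<close> for all \<open>X\<close>: the composite of two inner derivations
  is zero. As in Posner's theorem on prime rings of characteristic not two, one of the two
  derivations is then zero (lemma \<open>derivations_compose_zero_imp_scalar\<close>). A factor is a prime ring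
  (lemma \<open>factor_prime\<close>) with scalar centre, so \<open>A\<close> is a scalar whenever \<open>C\<close> is not, and
  \<open>\<tau>(C A) = 0\<close> with \<open>\<tau>(C) \<noteq> 0\<close> leaves only \<open>A = 0\<close>.
\<close>

notation blinfun_compose (infixl "\<cdot>" 70)

section \<open>Orthogonal projections and adjoints\<close>

text \<open>
  By the parallelogram law, a minimizing sequence for the distance from \<open>x\<close> to \<open>K\<close> is a Cauchy
  sequence, and at the nearest point the first variation along \<open>K\<close> vanishes.
\<close>

lemma closed_subspace_nearest_point_orthogonal:
  fixes K :: "'a::{real_inner, complete_space} set"
  assumes sub: "subspace K" and cl: "closed K"
  shows "\<exists>k\<in>K. \<forall>m\<in>K. (x - k) \<bullet> m = 0"
proof -
  define D where "D = (INF k\<in>K. (norm (x - k))\<^sup>2)"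
  have ne: "K \<noteq> {}" using subspace_0[OF sub] by auto
  have bdd: "bdd_below ((\<lambda>k. (norm (x - k))\<^sup>2) ` K)"
    by (rule bdd_belowI[where m = 0]) auto
  have D_le: "D \<le> (norm (x - k))\<^sup>2" if "k \<in> K" for k
    unfolding D_def by (rule cINF_lower[OF bdd that])
  have "\<exists>k\<in>K. (norm (x - k))\<^sup>2 < D + inverse (real (Suc n))" for n
  proof -
    have "(INF k\<in>K. (norm (x - k))\<^sup>2) < D + inverse (real (Suc n))"
      unfolding D_def by simp
    then show ?thesis using cINF_less_iff[OF ne bdd] by blast
  qed
  then obtain k where kK: "k n \<in> K"
    and k: "(norm (x - k n))\<^sup>2 < D + inverse (real (Suc n))" for n by metis
  have close: "(dist (k m) (k n))\<^sup>2 \<le> 2 * inverse (real (Suc m)) + 2 * inverse (real (Suc n))" for m n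
  proof -
    let ?mid = "(1/2) *\<^sub>R (k m + k n)"
    have "?mid \<in> K" using kK sub by (intro subspace_scale subspace_add)
    then have "D \<le> (norm (x - ?mid))\<^sup>2" by (rule D_le)
    moreover have "(dist (k m) (k n))\<^sup>2
        = 2 * (norm (x - k m))\<^sup>2 + 2 * (norm (x - k n))\<^sup>2 - 4 * (norm (x - ?mid))\<^sup>2"
      unfolding dist_norm power2_norm_eq_inner
      by (simp add: inner_diff_left inner_diff_right inner_add_left inner_add_right
          inner_commute algebra_simps)
    ultimately show ?thesis using k[of m] k[of n] by linarith
  qed
  have "Cauchy k"
  proof (rule metric_CauchyI)
    fix e :: real assume e: "e > 0"
    obtain N where N: "inverse (real (Suc N)) < e\<^sup>2 / 4"
      using reals_Archimedean[of "e\<^sup>2 / 4"] e by auto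
    have "dist (k m) (k n) < e" if "m \<ge> N" "n \<ge> N" for m n
    proof -
      have "inverse (real (Suc m)) \<le> inverse (real (Suc N))"
        "inverse (real (Suc n)) \<le> inverse (real (Suc N))"
        using that by (auto intro!: le_imp_inverse_le)
      then have "(dist (k m) (k n))\<^sup>2 < e\<^sup>2" using close[of m n] N by linarith
      then show ?thesis using e by (simp add: power2_less_imp_less)
    qed
    then show "\<exists>M. \<forall>m\<ge>M. \<forall>n\<ge>M. dist (k m) (k n) < e" by blast
  qed
  then obtain l where l: "k \<longlonglongrightarrow> l" using convergent_eq_Cauchy by (auto simp: convergent_def)
  have lK: "l \<in> K" using closed_sequentially[OF cl kK l] .
  have lD: "(norm (x - l))\<^sup>2 \<le> D"
  proof (rule LIMSEQ_le)
    show "(\<lambda>n. (norm (x - k n))\<^sup>2) \<longlonglongrightarrow> (norm (x - l))\<^sup>2" by (intro tendsto_intros l)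
    show "(\<lambda>n. D + inverse (real (Suc n))) \<longlonglongrightarrow> D"
      using tendsto_add[OF tendsto_const[of D] LIMSEQ_inverse_real_of_nat] by simp
    show "\<exists>N. \<forall>n\<ge>N. (norm (x - k n))\<^sup>2 \<le> D + inverse (real (Suc n))"
      using k less_imp_le by blast
  qed
  have "(x - l) \<bullet> m = 0" if m: "m \<in> K" for m
  proof (cases "m = 0")
    case False
    \<comment> \<open>\<open>l + t m\<close> is the nearest point to \<open>x\<close> on the line through \<open>l\<close> in direction \<open>m\<close>.\<close>
    define t where "t = ((x - l) \<bullet> m) / (m \<bullet> m)"
    have mm: "m \<bullet> m > 0" using False by simp
    have "l + t *\<^sub>R m \<in> K" using lK m sub by (intro subspace_add subspace_scale)
    then have "(norm (x - l))\<^sup>2 \<le> (norm (x - (l + t *\<^sub>R m)))\<^sup>2" using D_le lD by (meson order_trans)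
    also have "\<dots> = (norm (x - l))\<^sup>2 - 2 * t * ((x - l) \<bullet> m) + t\<^sup>2 * (m \<bullet> m)"
      unfolding power2_norm_eq_inner
      by (simp add: inner_diff_left inner_diff_right inner_add_left inner_add_right
          inner_commute algebra_simps power2_eq_square)
    finally have "2 * t * ((x - l) \<bullet> m) \<le> t\<^sup>2 * (m \<bullet> m)" by simp
    then have "((x - l) \<bullet> m)\<^sup>2 \<le> 0"
      using mm by (simp add: t_def power2_eq_square field_simps)
    then show ?thesis by simp
  qed simp
  then show ?thesis using lK by blast
qed

lemma riesz_representation:
  fixes f :: "'a::{real_inner, complete_space} \<Rightarrow> real"
  assumes f: "bounded_linear f"
  shows "\<exists>z. \<forall>x. f x = x \<bullet> z"
proof (cases "\<forall>x. f x = 0")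
  case False
  then obtain x where x: "f x \<noteq> 0" by blast
  interpret f: bounded_linear f by (rule f)
  have sub: "subspace {y. f y = 0}"
    by (auto simp: subspace_def f.add f.scaleR f.zero)
  have cl: "closed {y. f y = 0}"
    by (intro closed_Collect_eq continuous_intros f.continuous_on)
  obtain k where k: "f k = 0" and orth: "\<And>m. f m = 0 \<Longrightarrow> (x - k) \<bullet> m = 0"
    using closed_subspace_nearest_point_orthogonal[OF sub cl, of x] by blast
  define w where "w = x - k"
  have fw: "f w = f x" by (simp add: w_def f.diff k)
  then have w0: "w \<bullet> w \<noteq> 0" using x by (auto simp: f.zero)
  have "f y = y \<bullet> ((f w / (w \<bullet> w)) *\<^sub>R w)" for y
  proof -
    have "f (y - (f y / f w) *\<^sub>R w) = 0" using x fw by (simp add: f.diff f.scaleR)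
    then have "w \<bullet> (y - (f y / f w) *\<^sub>R w) = 0" using orth w_def by blast
    then have "y \<bullet> w = (f y / f w) * (w \<bullet> w)" by (simp add: inner_diff_right inner_commute)
    then show ?thesis using w0 x fw by simp
  qed
  then show ?thesis by blast
qed (auto intro!: exI[of _ 0])

lemma cinner_simps:
  fixes x y z :: "'h::complex_hilbert_space"
  shows "cinner x (y + z) = cinner x y + cinner x z"
    and "cinner x (a *\<^sub>C y) = cnj a * cinner x y"
    and "cinner 0 x = 0" and "cinner x 0 = 0"
    and "cinner (x - y) z = cinner x z - cinner y z"
    and "cinner x (y - z) = cinner x y - cinner x z"
    and "cinner (- x) y = - cinner x y" and "cinner x (- y) = - cinner x y"
proof -
  show add: "cinner x (y + z) = cinner x y + cinner x z" for x y z :: 'h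
    by (metis cinner_add_left cinner_commute complex_cnj_add)
  show "cinner x (a *\<^sub>C y) = cnj a * cinner x y"
    by (metis cinner_scaleC_left cinner_commute complex_cnj_mult)
  show z1: "cinner 0 x = 0" for x :: 'h
    using cinner_add_left[of 0 0 x] by simp
  show z2: "cinner x 0 = 0" for x :: 'h
    using add[of x 0 0] by simp
  show m1: "cinner (- x) y = - cinner x y" for x y :: 'h
    using cinner_add_left[of x "- x" y] z1 by (simp add: add_eq_0_iff)
  show m2: "cinner x (- y) = - cinner x y" for x y :: 'h
    using add[of x y "- y"] z2 by (simp add: add_eq_0_iff)
  show "cinner (x - y) z = cinner x z - cinner y z"
    using cinner_add_left[of x "- y" z] m1 by simp
  show "cinner x (y - z) = cinner x y - cinner x z"
    using add[of x y "- z"] m2 by simp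
qed

lemma scaleC_simps [simp]:
  fixes x :: "'h::complex_hilbert_space"
  shows "1 *\<^sub>C x = x" and "0 *\<^sub>C x = 0" and "(- 1) *\<^sub>C x = - x" and "a *\<^sub>C (0::'h) = 0"
  using scaleR_eq_scaleC[of 1 x] scaleR_eq_scaleC[of 0 x] scaleR_eq_scaleC[of "-1" x]
    norm_scaleC[of a "0::'h"]
  by simp_all

lemma cinner_eq_inner:
  fixes x y :: "'h::complex_hilbert_space"
  shows "cinner x y = Complex (x \<bullet> y) (x \<bullet> (\<i> *\<^sub>C y))"
  by (simp add: complex_eq_iff inner_eq_Re_cinner cinner_simps)

lemma cinner_ext:
  fixes y z :: "'h::complex_hilbert_space"
  assumes "\<And>x. cinner x y = cinner x z"
  shows "y = z"
proof -
  have "inner (y - z) (y - z) = 0"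
    using assms[of "y - z"] by (simp add: inner_eq_Re_cinner cinner_simps)
  then show ?thesis by simp
qed

lemma bounded_operators_scaleC:
  "A \<in> bounded_operators \<Longrightarrow> blinfun_apply A (c *\<^sub>C x) = c *\<^sub>C blinfun_apply A x"
  by (auto simp: bounded_operators_def)

lemma adj_unique:
  assumes "\<And>x y. cinner (blinfun_apply A x) y = cinner x (blinfun_apply B y)"
  shows "adj A = B"
  unfolding adj_def
proof (rule the_equality)
  show "\<forall>x y. cinner (blinfun_apply A x) y = cinner x (blinfun_apply B y)" using assms by blast
next
  fix B' assume B': "\<forall>x y. cinner (blinfun_apply A x) y = cinner x (blinfun_apply B' y)"
  show "B' = B"
    by (rule blinfun_eqI, rule cinner_ext) (metis B' assms)
qed

text \<open>
  The constant \<open>adj\<close> is a definite description, so its defining property needs the existence of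
  an adjoint. The Riesz theorem for the real inner product yields a real adjoint; complex
  linearity of \<open>A\<close> carries the identity over from real to imaginary parts.
\<close>

lemma cinner_adj:
  assumes A: "A \<in> bounded_operators"
  shows "cinner (blinfun_apply A x) y = cinner x (blinfun_apply (adj A) y)"
proof -
  have "\<exists>z. \<forall>x. blinfun_apply A x \<bullet> y = x \<bullet> z" for y
    by (rule riesz_representation)
      (intro bounded_linear_compose[OF bounded_linear_inner_left blinfun.bounded_linear_right])
  then obtain g where g: "\<And>x y. blinfun_apply A x \<bullet> y = x \<bullet> g y" by metis
  have cg: "cinner (blinfun_apply A x) y = cinner x (g y)" for x y
  proof (rule complex_eqI)
    show "Re (cinner (blinfun_apply A x) y) = Re (cinner x (g y))"
      using g by (simp add: inner_eq_Re_cinner)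
    have "Re (cinner (blinfun_apply A (\<i> *\<^sub>C x)) y) = Re (cinner (\<i> *\<^sub>C x) (g y))"
      using g[of "\<i> *\<^sub>C x" y] by (simp add: inner_eq_Re_cinner)
    then show "Im (cinner (blinfun_apply A x) y) = Im (cinner x (g y))"
      by (simp add: bounded_operators_scaleC[OF A] cinner_scaleC_left)
  qed
  have "bounded_linear g"
  proof (rule bounded_linear_intro[where K = "norm A"])
    fix x y and r :: real
    show "g (x + y) = g x + g y"
      by (rule cinner_ext) (simp add: cinner_simps flip: cg)
    show "g (r *\<^sub>R x) = r *\<^sub>R g x"
      by (rule cinner_ext) (simp add: scaleR_eq_scaleC cinner_simps flip: cg)
    have "norm (g x) * norm (g x) = blinfun_apply A (g x) \<bullet> x"
      by (simp add: g flip: power2_norm_eq_inner power2_eq_square)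
    also have "\<dots> \<le> norm (blinfun_apply A (g x)) * norm x" by (rule norm_cauchy_schwarz)
    also have "\<dots> \<le> norm A * norm (g x) * norm x"
      by (intro mult_right_mono norm_blinfun) auto
    finally have "norm (g x) * norm (g x) \<le> norm (g x) * (norm x * norm A)"
      by (simp add: mult_ac)
    then show "norm (g x) \<le> norm x * norm A"
      by (cases "norm (g x) = 0") auto
  qed
  then have "cinner (blinfun_apply A x) y = cinner x (blinfun_apply (Blinfun g) y)" for x y
    by (simp add: bounded_linear_Blinfun_apply cg)
  then show ?thesis using adj_unique by metis
qed

section \<open>Operator algebra\<close>

lemma scaleC_blinfun_apply [simp]: "blinfun_apply (c *\<^sub>C A) x = c *\<^sub>C blinfun_apply A x"
  by (simp add: scaleC_blinfun.rep_eq)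

lemma bounded_operators_closed [simp, intro]:
  fixes A B :: "'h::complex_hilbert_space \<Rightarrow>\<^sub>L 'h"
  shows "id_blinfun \<in> (bounded_operators :: ('h \<Rightarrow>\<^sub>L 'h) set)"
    and "A \<in> bounded_operators \<Longrightarrow> B \<in> bounded_operators \<Longrightarrow> A + B \<in> bounded_operators"
    and "A \<in> bounded_operators \<Longrightarrow> B \<in> bounded_operators \<Longrightarrow> A \<cdot> B \<in> bounded_operators"
    and "A \<in> bounded_operators \<Longrightarrow> c *\<^sub>C A \<in> bounded_operators"
  by (auto simp: bounded_operators_def blinfun.bilinear_simps scaleC_add_right scaleC_scaleC
      mult.commute)

lemma adj_bounded_operators [simp, intro]:
  assumes "A \<in> bounded_operators"
  shows "adj A \<in> bounded_operators"
  unfolding bounded_operators_def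
proof (intro CollectI allI)
  fix c x
  show "blinfun_apply (adj A) (c *\<^sub>C x) = c *\<^sub>C blinfun_apply (adj A) x"
    by (rule cinner_ext) (simp add: cinner_simps flip: cinner_adj[OF assms])
qed

lemma blinfun_scaleC_simps:
  fixes A B :: "'h::complex_hilbert_space \<Rightarrow>\<^sub>L 'h"
  shows "1 *\<^sub>C A = A" and "0 *\<^sub>C A = 0" and "(- 1) *\<^sub>C A = - A"
    and "a *\<^sub>C b *\<^sub>C A = (a * b) *\<^sub>C A"
    and "a *\<^sub>C (A + B) = a *\<^sub>C A + a *\<^sub>C B"
    and "a *\<^sub>C (A - B) = a *\<^sub>C A - a *\<^sub>C B"
    and "(a + b) *\<^sub>C A = a *\<^sub>C A + b *\<^sub>C A"
    and "(- a) *\<^sub>C A = - (a *\<^sub>C A)" and "a *\<^sub>C (- A) = - (a *\<^sub>C A)"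
    and "a *\<^sub>C (0 :: 'h \<Rightarrow>\<^sub>L 'h) = 0"
proof -
  have neg: "a *\<^sub>C (- x) = - (a *\<^sub>C x)" "(- a) *\<^sub>C x = - (a *\<^sub>C x)" for a and x :: 'h
    using scaleC_scaleC[of a "-1" x] scaleC_scaleC[of "-1" a x] by simp_all
  have diff: "a *\<^sub>C (x - y) = a *\<^sub>C x - a *\<^sub>C y" for a and x y :: 'h
    using scaleC_add_right[of a x "- y"] neg by simp
  show "1 *\<^sub>C A = A" "0 *\<^sub>C A = 0" "(- 1) *\<^sub>C A = - A"
    "a *\<^sub>C b *\<^sub>C A = (a * b) *\<^sub>C A"
    "a *\<^sub>C (A + B) = a *\<^sub>C A + a *\<^sub>C B"
    "a *\<^sub>C (A - B) = a *\<^sub>C A - a *\<^sub>C B"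
    "(a + b) *\<^sub>C A = a *\<^sub>C A + b *\<^sub>C A"
    "(- a) *\<^sub>C A = - (a *\<^sub>C A)" "a *\<^sub>C (- A) = - (a *\<^sub>C A)"
    "a *\<^sub>C (0 :: 'h \<Rightarrow>\<^sub>L 'h) = 0"
    by (auto intro!: blinfun_eqI
        simp: blinfun.bilinear_simps scaleC_add_right scaleC_add_left scaleC_scaleC neg diff)
qed

lemma compose_scaleC_left: "(c *\<^sub>C A) \<cdot> B = c *\<^sub>C (A \<cdot> B)"
  by (rule blinfun_eqI) simp

lemma compose_scaleC_right:
  "A \<in> bounded_operators \<Longrightarrow> A \<cdot> (c *\<^sub>C B) = c *\<^sub>C (A \<cdot> B)"
  by (rule blinfun_eqI) (simp add: bounded_operators_scaleC)

lemma compose_assoc: "(A \<cdot> B) \<cdot> D = A \<cdot> (B \<cdot> D)"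
  by (rule blinfun_eqI) simp

lemma compose_id [simp]: "id_blinfun \<cdot> A = A" "A \<cdot> id_blinfun = A"
  by (rule blinfun_eqI, simp)+

lemma compose_distribs:
  "(A + B) \<cdot> D = A \<cdot> D + B \<cdot> D" "A \<cdot> (D + E) = A \<cdot> D + A \<cdot> E"
  "(A - B) \<cdot> D = A \<cdot> D - B \<cdot> D" "A \<cdot> (D - E) = A \<cdot> D - A \<cdot> E"
  "(- A) \<cdot> D = - (A \<cdot> D)" "A \<cdot> (- D) = - (A \<cdot> D)"
  by (auto intro!: blinfun_eqI simp: blinfun.bilinear_simps)

lemmas operator_ring_simps = compose_assoc compose_distribs

lemma adj_id [simp]: "adj id_blinfun = (id_blinfun :: 'h::complex_hilbert_space \<Rightarrow>\<^sub>L 'h)"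
  by (rule adj_unique) simp

lemma adj_scaleC: "A \<in> bounded_operators \<Longrightarrow> adj (c *\<^sub>C A) = cnj c *\<^sub>C adj A"
  by (rule adj_unique) (simp add: cinner_simps cinner_scaleC_left cinner_adj)

lemma adj_add:
  "A \<in> bounded_operators \<Longrightarrow> B \<in> bounded_operators \<Longrightarrow> adj (A + B) = adj A + adj B"
  by (rule adj_unique) (simp add: cinner_simps cinner_add_left cinner_adj blinfun.bilinear_simps)

lemma adj_compose:
  "A \<in> bounded_operators \<Longrightarrow> B \<in> bounded_operators \<Longrightarrow> adj (A \<cdot> B) = adj B \<cdot> adj A"
  by (rule adj_unique) (simp add: cinner_adj)

lemma adj_adj: "A \<in> bounded_operators \<Longrightarrow> adj (adj A) = A"
  by (rule adj_unique) (metis cinner_adj cinner_commute)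

lemma adj_uminus: "A \<in> bounded_operators \<Longrightarrow> adj (- A) = - adj A"
  using adj_scaleC[of A "-1"] by (simp add: blinfun_scaleC_simps)

lemma bounded_operators_diff [simp, intro]:
  "A \<in> bounded_operators \<Longrightarrow> B \<in> bounded_operators \<Longrightarrow> A - B \<in> bounded_operators"
  using bounded_operators_closed(2)[of A "(-1) *\<^sub>C B"] bounded_operators_closed(4)[of B "-1"]
  by (simp add: blinfun_scaleC_simps)

lemma bounded_operators_uminus [simp, intro]:
  "A \<in> bounded_operators \<Longrightarrow> - A \<in> bounded_operators"
  using bounded_operators_closed(4)[of A "-1"] by (simp add: blinfun_scaleC_simps)

lemma adj_diff:
  "A \<in> bounded_operators \<Longrightarrow> B \<in> bounded_operators \<Longrightarrow> adj (A - B) = adj A - adj B"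
  using adj_add[of A "- B"] by (simp add: adj_uminus)

section \<open>Von Neumann algebras\<close>

locale von_neumann =
  fixes M :: "('h::complex_hilbert_space \<Rightarrow>\<^sub>L 'h) set"
  assumes vN: "von_neumann_algebra M"
begin

lemma bounded: "A \<in> M \<Longrightarrow> A \<in> bounded_operators"
  using vN by (auto simp: von_neumann_algebra_def)

lemma adj_closed [simp, intro]: "A \<in> M \<Longrightarrow> adj A \<in> M"
  using vN by (auto simp: von_neumann_algebra_def)

lemma bicommutant_mem:
  assumes "A \<in> bounded_operators" "\<And>B. B \<in> commutant M \<Longrightarrow> B \<cdot> A = A \<cdot> B"
  shows "A \<in> M"
  using vN assms by (auto simp: von_neumann_algebra_def commutant_def)

lemma commutant_commutes: "B \<in> commutant M \<Longrightarrow> A \<in> M \<Longrightarrow> A \<cdot> B = B \<cdot> A"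
  and commutant_bounded: "B \<in> commutant M \<Longrightarrow> B \<in> bounded_operators"
  by (auto simp: commutant_def)

lemma algebra_closed [simp, intro]:
  shows id_closed: "id_blinfun \<in> M"
    and add_closed: "A \<in> M \<Longrightarrow> B \<in> M \<Longrightarrow> A + B \<in> M"
    and compose_closed: "A \<in> M \<Longrightarrow> B \<in> M \<Longrightarrow> A \<cdot> B \<in> M"
    and scaleC_closed: "A \<in> M \<Longrightarrow> c *\<^sub>C A \<in> M"
proof -
  show "id_blinfun \<in> M" by (rule bicommutant_mem) auto
  show "A + B \<in> M" if "A \<in> M" "B \<in> M"
    by (rule bicommutant_mem)
      (use that commutant_commutes in \<open>auto simp: bounded operator_ring_simps\<close>)
  show "A \<cdot> B \<in> M" if "A \<in> M" "B \<in> M"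
    by (rule bicommutant_mem)
      (use that commutant_commutes in \<open>auto simp: bounded, metis compose_assoc\<close>)
  show "c *\<^sub>C A \<in> M" if "A \<in> M"
    by (rule bicommutant_mem)
      (use that commutant_commutes commutant_bounded
        in \<open>auto simp: bounded compose_scaleC_left compose_scaleC_right\<close>)
qed

lemma uminus_closed [simp, intro]: "A \<in> M \<Longrightarrow> - A \<in> M"
  using scaleC_closed[of A "-1"] by (simp add: blinfun_scaleC_simps)

lemma diff_closed [simp, intro]: "A \<in> M \<Longrightarrow> B \<in> M \<Longrightarrow> A - B \<in> M"
  using add_closed[of A "- B"] by auto

lemma zero_closed [simp, intro]: "0 \<in> M"
  using diff_closed[OF id_closed id_closed] by simp

lemma commutant_adj_closed:
  assumes B: "B \<in> commutant M"
  shows "adj B \<in> commutant M"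
  unfolding commutant_def
proof (intro CollectI conjI ballI)
  show "adj B \<in> bounded_operators" using B commutant_bounded by auto
  fix A assume A: "A \<in> M"
  have "adj (adj A \<cdot> B) = adj (B \<cdot> adj A)" using commutant_commutes[OF B] A by simp
  then show "A \<cdot> adj B = adj B \<cdot> A"
    using A B by (simp add: adj_compose adj_adj bounded commutant_bounded)
qed

lemma unitaries_id [simp]: "id_blinfun \<in> unitaries M"
  by (simp add: unitaries_def)

lemma unitaries_mem: "U \<in> unitaries M \<Longrightarrow> U \<in> M"
  by (simp add: unitaries_def)

lemma unitary_adj_cancel [simp]:
  assumes "U \<in> unitaries M"
  shows "adj U \<cdot> U = id_blinfun" "U \<cdot> adj U = id_blinfun"
    "adj U \<cdot> (U \<cdot> A) = A" "U \<cdot> (adj U \<cdot> A) = A"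
  using assms by (auto simp: unitaries_def simp flip: compose_assoc)

lemma unitaries_compose [simp]:
  assumes "U \<in> unitaries M" "V \<in> unitaries M"
  shows "U \<cdot> V \<in> unitaries M"
  using assms unitaries_mem[OF assms(1)] unitaries_mem[OF assms(2)]
  unfolding unitaries_def[of M] by (simp add: adj_compose bounded compose_assoc)
    (simp flip: compose_assoc)

lemma real_imaginary_parts:
  assumes "X \<in> M"
  obtains H K where "H \<in> M" "adj H = H" "K \<in> M" "adj K = K" "X = H + \<i> *\<^sub>C K"
proof
  let ?H = "(1/2) *\<^sub>C (X + adj X)" and ?K = "(- \<i> / 2) *\<^sub>C (X - adj X)"
  show "?H \<in> M" "?K \<in> M" using assms by auto
  show "adj ?H = ?H" "adj ?K = ?K"
    using assms by (auto simp: adj_scaleC adj_add adj_diff adj_adj bounded blinfun_scaleC_simps)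
  have "?H + \<i> *\<^sub>C ?K = (1/2) *\<^sub>C X + (1/2) *\<^sub>C X"
    by (simp add: blinfun_scaleC_simps(4,5,6))
  also have "\<dots> = X"
    by (simp add: blinfun_scaleC_simps(1) flip: blinfun_scaleC_simps(7))
  finally show "X = ?H + \<i> *\<^sub>C ?K" ..
qed

end

section \<open>Resolvents of skew-adjoint operators\<close>

text \<open>
  The solution \<open>x\<close> of \<open>x - T x = y\<close> is the fixed point of the contraction \<open>x \<mapsto> y + T x\<close>.
\<close>

lemma neumann_inverse:
  fixes T :: "'h::complex_hilbert_space \<Rightarrow>\<^sub>L 'h"
  assumes T: "T \<in> bounded_operators" and small: "norm T < 1"
  shows "\<exists>R\<in>bounded_operators. R \<cdot> (id_blinfun - T) = id_blinfun \<and> (id_blinfun - T) \<cdot> R = id_blinfun"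
proof -
  have "\<exists>!x. y + blinfun_apply T x = x" for y
  proof (rule banach_fix_type[OF norm_ge_zero small], intro allI)
    fix x x'
    show "dist (y + blinfun_apply T x) (y + blinfun_apply T x') \<le> norm T * dist x x'"
      using norm_blinfun[of T "x - x'"] by (simp add: dist_norm blinfun.diff_right)
  qed
  then obtain r where r: "\<And>y. y + blinfun_apply T (r y) = r y"
    and uniq: "\<And>x y. y + blinfun_apply T x = x \<Longrightarrow> x = r y" by metis
  have lin: "bounded_linear r"
  proof (rule bounded_linear_intro[where K = "1 / (1 - norm T)"])
    fix x y and c :: real
    have "(x + y) + blinfun_apply T (r x + r y)
        = (x + blinfun_apply T (r x)) + (y + blinfun_apply T (r y))"
      by (simp add: blinfun.add_right)
    then have "(x + y) + blinfun_apply T (r x + r y) = r x + r y" unfolding r .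
    then show "r (x + y) = r x + r y" by (rule uniq[symmetric])
    have "c *\<^sub>R x + blinfun_apply T (c *\<^sub>R r x) = c *\<^sub>R r x"
      using r[of x] by (simp add: blinfun.scaleR_right flip: scaleR_right_distrib)
    then show "r (c *\<^sub>R x) = c *\<^sub>R r x" by (rule uniq[symmetric])
    have "norm (r x) \<le> norm x + norm (blinfun_apply T (r x))"
      using r[of x] norm_triangle_ineq by metis
    also have "\<dots> \<le> norm x + norm T * norm (r x)" using norm_blinfun by auto
    finally have "(1 - norm T) * norm (r x) \<le> norm x" by (simp add: algebra_simps)
    then show "norm (r x) \<le> norm x * (1 / (1 - norm T))"
      using small by (simp add: field_simps)
  qed
  let ?R = "Blinfun r"
  have R: "blinfun_apply ?R = r" by (simp add: bounded_linear_Blinfun_apply[OF lin])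
  have "r (c *\<^sub>C x) = c *\<^sub>C r x" for c x
    using r[of x] by (intro uniq[symmetric])
      (metis bounded_operators_scaleC[OF T] scaleC_add_right)
  then have "?R \<in> bounded_operators" by (simp add: bounded_operators_def R)
  moreover have "?R \<cdot> (id_blinfun - T) = id_blinfun"
    by (rule blinfun_eqI) (simp add: R blinfun.bilinear_simps, rule uniq[symmetric], simp)
  moreover have "(id_blinfun - T) \<cdot> ?R = id_blinfun"
    by (rule blinfun_eqI) (simp add: R blinfun.bilinear_simps, metis r add_diff_cancel_right')
  ultimately show ?thesis by blast
qed

context von_neumann
begin

text \<open>
  The double commutant condition puts inverses into the algebra: whatever commutes with \<open>S\<close>
  commutes with its inverse.
\<close>

lemma inverse_closed:
  assumes "S \<in> M" "R \<in> bounded_operators" and RS: "R \<cdot> S = id_blinfun" "S \<cdot> R = id_blinfun"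
  shows "R \<in> M"
proof (rule bicommutant_mem[OF assms(2)])
  fix B assume "B \<in> commutant M"
  then have "S \<cdot> B = B \<cdot> S" using assms(1) commutant_commutes by blast
  then have "R \<cdot> (S \<cdot> B) \<cdot> R = R \<cdot> (B \<cdot> S) \<cdot> R" by simp
  then show "B \<cdot> R = R \<cdot> B"
    by (metis RS compose_assoc compose_id)
qed

text \<open>
  The two equations say \<open>R = (I - T)\<^sup>-\<^sup>1\<close>. In the form given they are rewrite rules which, together
  with their adjoints, remove every product of \<open>T\<close> with \<open>R\<close> or \<open>R\<^sup>*\<close>.
\<close>

definition resolvent :: "('h \<Rightarrow>\<^sub>L 'h) \<Rightarrow> ('h \<Rightarrow>\<^sub>L 'h) \<Rightarrow> bool" where
  "resolvent T R \<longleftrightarrow> T \<in> M \<and> adj T = - T \<and> R \<in> M \<and>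
     R \<cdot> T = R - id_blinfun \<and> T \<cdot> R = R - id_blinfun"

lemma resolvent_exists:
  assumes H: "H \<in> M" "adj H = H" and small: "\<bar>s\<bar> * norm H < 1"
  shows "\<exists>R. resolvent ((\<i> * complex_of_real s) *\<^sub>C H) R"
proof -
  let ?T = "(\<i> * complex_of_real s) *\<^sub>C H"
  have T: "?T \<in> M" using H by auto
  have "norm ?T \<le> \<bar>s\<bar> * norm H"
  proof (rule norm_blinfun_bound)
    show "norm (blinfun_apply ?T x) \<le> \<bar>s\<bar> * norm H * norm x" for x
      using norm_blinfun[of H x] by (simp add: norm_scaleC norm_mult mult.assoc mult_left_mono)
  qed auto
  then have "norm ?T < 1" using small by simp
  then obtain R where R: "R \<in> bounded_operators"
    "R \<cdot> (id_blinfun - ?T) = id_blinfun" "(id_blinfun - ?T) \<cdot> R = id_blinfun"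
    using neumann_inverse[OF bounded[OF T]] by blast
  have "R \<in> M" by (rule inverse_closed[OF _ R]) (use T in auto)
  moreover have "R \<cdot> ?T = R - id_blinfun" "?T \<cdot> R = R - id_blinfun"
    using R(2,3) unfolding compose_distribs compose_id by (simp_all add: algebra_simps)
  moreover have "adj ?T = - ?T"
    using H by (simp add: adj_scaleC bounded blinfun_scaleC_simps)
  ultimately show ?thesis using T unfolding resolvent_def by blast
qed

lemma resolvent_adj:
  assumes "resolvent T R"
  shows "resolvent (- T) (adj R)"
proof -
  have r: "T \<in> M" "adj T = - T" "R \<in> M" "R \<cdot> T = R - id_blinfun" "T \<cdot> R = R - id_blinfun"
    using assms by (auto simp: resolvent_def)
  have "- T \<cdot> adj R = adj (R \<cdot> T)" "adj R \<cdot> (- T) = adj (T \<cdot> R)"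
    using adj_compose[of R T] adj_compose[of T R] r(1-3) by (simp_all add: bounded)
  then have "- T \<cdot> adj R = adj R - id_blinfun" "adj R \<cdot> (- T) = adj R - id_blinfun"
    unfolding r(4,5) using r(3) by (simp_all add: adj_diff bounded)
  then show ?thesis using r by (simp add: resolvent_def adj_uminus bounded)
qed

lemma resolvent_simps:
  assumes "resolvent T R"
  shows "R \<cdot> T = R - id_blinfun" "T \<cdot> R = R - id_blinfun"
    "adj R \<cdot> T = id_blinfun - adj R" "T \<cdot> adj R = id_blinfun - adj R"
    "R \<cdot> (T \<cdot> X) = R \<cdot> X - X" "T \<cdot> (R \<cdot> X) = R \<cdot> X - X"
    "adj R \<cdot> (T \<cdot> X) = X - adj R \<cdot> X" "T \<cdot> (adj R \<cdot> X) = X - adj R \<cdot> X"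
proof -
  show *: "R \<cdot> T = R - id_blinfun" "T \<cdot> R = R - id_blinfun"
    using assms by (auto simp: resolvent_def)
  have "- (adj R \<cdot> T) = adj R - id_blinfun" "- (T \<cdot> adj R) = adj R - id_blinfun"
    using resolvent_adj[OF assms] by (simp_all add: resolvent_def compose_distribs)
  then show **: "adj R \<cdot> T = id_blinfun - adj R" "T \<cdot> adj R = id_blinfun - adj R"
    by (metis minus_diff_eq minus_minus)+
  show "R \<cdot> (T \<cdot> X) = R \<cdot> X - X" "T \<cdot> (R \<cdot> X) = R \<cdot> X - X"
    "adj R \<cdot> (T \<cdot> X) = X - adj R \<cdot> X" "T \<cdot> (adj R \<cdot> X) = X - adj R \<cdot> X"
    unfolding compose_assoc[symmetric] * ** by (simp_all add: compose_distribs)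
qed

lemma resolvent_closed: "resolvent T R \<Longrightarrow> T \<in> M" "resolvent T R \<Longrightarrow> R \<in> M"
  by (auto simp: resolvent_def)

text \<open>
  Both identities come from evaluating \<open>R\<^sup>* T R\<close> and \<open>R T R\<^sup>*\<close> in two ways.
\<close>

lemma resolvent_normal:
  assumes "resolvent T R"
  shows "adj R \<cdot> R + adj R \<cdot> R = R + adj R" "R \<cdot> adj R + R \<cdot> adj R = R + adj R"
proof -
  note rs = resolvent_simps[OF assms]
  have "adj R \<cdot> (T \<cdot> R) = (adj R \<cdot> T) \<cdot> R" by (simp add: compose_assoc)
  then show "adj R \<cdot> R + adj R \<cdot> R = R + adj R"
    unfolding rs(2,3) by (simp add: compose_distribs algebra_simps)
  have "R \<cdot> (T \<cdot> adj R) = (R \<cdot> T) \<cdot> adj R" by (simp add: compose_assoc)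
  then show "R \<cdot> adj R + R \<cdot> adj R = R + adj R"
    unfolding rs(1,4) by (simp add: compose_distribs algebra_simps)
qed

text \<open>
  Since \<open>I + T = 2 I - (I - T)\<close>, the Cayley transform \<open>(I + T) (I - T)\<^sup>-\<^sup>1\<close> equals \<open>2 R - I\<close>. In this
  form unitarity is the statement of \<open>resolvent_normal\<close>, and the second claim, an exact
  replacement for the first-order expansion of \<open>U A U\<^sup>*\<close>, is an identity between words in
  \<open>R\<close>, \<open>R\<^sup>*\<close> and \<open>A\<close>.
\<close>

lemma cayley_unitary:
  assumes "resolvent T R"
  shows "R + R - id_blinfun \<in> unitaries M"
    and "(R + R - id_blinfun) \<cdot> A \<cdot> adj (R + R - id_blinfun)
      = A + 2 *\<^sub>R (R \<cdot> (T \<cdot> A - A \<cdot> T) \<cdot> adj R)"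
proof -
  note rs = resolvent_simps[OF assms] and nrm = resolvent_normal[OF assms]
  have R: "R \<in> M" using assms by (rule resolvent_closed)
  let ?U = "R + R - id_blinfun"
  have adjU: "adj ?U = adj R + adj R - id_blinfun"
    using R by (simp add: adj_add adj_diff bounded)
  have "adj ?U \<cdot> ?U = 2 *\<^sub>R (adj R \<cdot> R + adj R \<cdot> R) - (R + adj R) - (R + adj R) + id_blinfun"
    unfolding adjU by (simp add: compose_distribs algebra_simps scaleR_2)
  moreover have "?U \<cdot> adj ?U = 2 *\<^sub>R (R \<cdot> adj R + R \<cdot> adj R) - (R + adj R) - (R + adj R) + id_blinfun"
    unfolding adjU by (simp add: compose_distribs algebra_simps scaleR_2)
  ultimately show "?U \<in> unitaries M"
    using R unfolding unitaries_def nrm by (simp add: scaleR_2)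
  show "?U \<cdot> A \<cdot> adj ?U = A + 2 *\<^sub>R (R \<cdot> (T \<cdot> A - A \<cdot> T) \<cdot> adj R)"
    unfolding adjU by (simp add: operator_ring_simps rs algebra_simps scaleR_2)
qed

end

section \<open>Tracial states\<close>

locale tracial_von_neumann = von_neumann M for M :: "('h::complex_hilbert_space \<Rightarrow>\<^sub>L 'h) set" +
  fixes \<tau> :: "('h \<Rightarrow>\<^sub>L 'h) \<Rightarrow> complex"
  assumes trace: "faithful_normal_tracial_state M \<tau>"
begin

lemma trace_linear:
  shows trace_add: "A \<in> M \<Longrightarrow> B \<in> M \<Longrightarrow> \<tau> (A + B) = \<tau> A + \<tau> B"
    and trace_scaleC: "A \<in> M \<Longrightarrow> \<tau> (c *\<^sub>C A) = c * \<tau> A"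
    and trace_id: "\<tau> id_blinfun = 1"
  using trace
  by (auto simp: faithful_normal_tracial_state_def state_on_def linear_functional_on_def)

lemma trace_uminus: "A \<in> M \<Longrightarrow> \<tau> (- A) = - \<tau> A"
  using trace_scaleC[of A "-1"] by (simp add: blinfun_scaleC_simps)

lemma trace_diff: "A \<in> M \<Longrightarrow> B \<in> M \<Longrightarrow> \<tau> (A - B) = \<tau> A - \<tau> B"
  using trace_add[of A "- B"] by (simp add: trace_uminus)

lemma trace_zero [simp]: "\<tau> 0 = 0"
  using trace_diff[of id_blinfun id_blinfun] by simp

lemma trace_commute: "A \<in> M \<Longrightarrow> B \<in> M \<Longrightarrow> \<tau> (A \<cdot> B) = \<tau> (B \<cdot> A)"
  using trace by (auto simp: faithful_normal_tracial_state_def)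

lemma trace_faithful: "A \<in> M \<Longrightarrow> \<tau> (adj A \<cdot> A) = 0 \<Longrightarrow> A = 0"
  using trace by (auto simp: faithful_normal_tracial_state_def)

text \<open>
  The squared norm of the Hilbert space that the trace defines on \<open>M\<close>.
\<close>

definition sqnorm2 :: "('h \<Rightarrow>\<^sub>L 'h) \<Rightarrow> real" where
  "sqnorm2 A = Re (\<tau> (adj A \<cdot> A))"

lemma trace_adj_self: "A \<in> M \<Longrightarrow> \<tau> (adj A \<cdot> A) = of_real (sqnorm2 A)"
  and sqnorm2_nonneg: "A \<in> M \<Longrightarrow> 0 \<le> sqnorm2 A"
  using trace
  by (auto simp: faithful_normal_tracial_state_def state_on_def sqnorm2_def
      nonneg_Reals_def elim!: nonneg_Reals_cases)

lemma sqnorm2_adj: "A \<in> M \<Longrightarrow> sqnorm2 (adj A) = sqnorm2 A"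
  by (simp add: sqnorm2_def adj_adj bounded trace_commute)

lemma sqnorm2_id: "sqnorm2 id_blinfun = 1"
  by (simp add: sqnorm2_def trace_id)

lemma sqnorm2_unitary_conj:
  assumes "U \<in> unitaries M" "A \<in> M"
  shows "sqnorm2 (U \<cdot> A \<cdot> adj U) = sqnorm2 A"
proof -
  have "adj (U \<cdot> A \<cdot> adj U) \<cdot> (U \<cdot> A \<cdot> adj U) = U \<cdot> (adj A \<cdot> A \<cdot> adj U)"
    using assms unitaries_mem[OF assms(1)]
    by (simp add: adj_compose adj_adj bounded compose_assoc)
  moreover have "\<tau> (U \<cdot> (adj A \<cdot> A \<cdot> adj U)) = \<tau> (adj A \<cdot> A \<cdot> adj U \<cdot> U)"
    using assms unitaries_mem[OF assms(1)] by (intro trace_commute) auto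
  moreover have "adj A \<cdot> A \<cdot> adj U \<cdot> U = adj A \<cdot> A"
    using assms(1) by (simp add: compose_assoc)
  ultimately show ?thesis by (simp only: sqnorm2_def)
qed

text \<open>
  A weak form of the Cauchy-Schwarz inequality, obtained from polarization and the parallelogram law.
  It only has to show that traces of products stay bounded, so the constant is immaterial.
\<close>

lemma trace_adj_bound:
  assumes X: "X \<in> M" and Y: "Y \<in> M"
  shows "cmod (\<tau> (adj X \<cdot> Y)) \<le> 2 * sqnorm2 X + 2 * sqnorm2 Y"
proof -
  define e where "e c = \<tau> (adj (X + c *\<^sub>C Y) \<cdot> (X + c *\<^sub>C Y))" for c
  have expand: "e c = of_real (sqnorm2 X) + c * \<tau> (adj X \<cdot> Y) + cnj c * \<tau> (adj Y \<cdot> X)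
      + (c * cnj c) * of_real (sqnorm2 Y)" for c
  proof -
    have "adj (X + c *\<^sub>C Y) \<cdot> (X + c *\<^sub>C Y) = adj X \<cdot> X + c *\<^sub>C (adj X \<cdot> Y)
        + cnj c *\<^sub>C (adj Y \<cdot> X) + (c * cnj c) *\<^sub>C (adj Y \<cdot> Y)"
      using X Y by (simp add: adj_add adj_scaleC bounded compose_distribs compose_scaleC_left
          compose_scaleC_right blinfun_scaleC_simps mult.commute)
    then show ?thesis using X Y by (simp add: e_def trace_add trace_scaleC trace_adj_self)
  qed
  have bound: "cmod (e c) \<le> 2 * sqnorm2 X + 2 * sqnorm2 Y" if "c * cnj c = 1" for c
  proof -
    have e: "e c = of_real (sqnorm2 (X + c *\<^sub>C Y))" "e (- c) = of_real (sqnorm2 (X + (- c) *\<^sub>C Y))"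
      unfolding e_def by (rule trace_adj_self, use X Y in auto)+
    have "e c + e (- c) = of_real (2 * sqnorm2 X + 2 * sqnorm2 Y)"
      using that by (simp add: expand)
    then have "sqnorm2 (X + c *\<^sub>C Y) + sqnorm2 (X + (- c) *\<^sub>C Y) = 2 * sqnorm2 X + 2 * sqnorm2 Y"
      unfolding e by (metis of_real_add of_real_eq_iff)
    moreover have "0 \<le> sqnorm2 (X + c *\<^sub>C Y)" "0 \<le> sqnorm2 (X + (- c) *\<^sub>C Y)"
      by (rule sqnorm2_nonneg, use X Y in auto)+
    ultimately show ?thesis unfolding e by simp
  qed
  have "4 * \<tau> (adj X \<cdot> Y) = e 1 - e (- 1) + (- \<i>) * e \<i> + \<i> * e (- \<i>)"
    unfolding expand by (simp add: algebra_simps)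
  then have "cmod (4 * \<tau> (adj X \<cdot> Y)) = cmod (e 1 - e (- 1) + (- \<i>) * e \<i> + \<i> * e (- \<i>))"
    by (rule arg_cong)
  then have "4 * cmod (\<tau> (adj X \<cdot> Y)) \<le> cmod (e 1) + cmod (e (- 1)) + cmod (e \<i>) + cmod (e (- \<i>))"
    using norm_triangle_ineq[of "e 1 - e (- 1) + (- \<i>) * e \<i>" "\<i> * e (- \<i>)"]
      norm_triangle_ineq[of "e 1 - e (- 1)" "(- \<i>) * e \<i>"] norm_triangle_ineq4[of "e 1" "e (- 1)"]
    unfolding norm_mult norm_minus_cancel norm_ii norm_numeral by linarith
  also have "\<dots> \<le> 4 * (2 * sqnorm2 X + 2 * sqnorm2 Y)"
    using bound[of 1] bound[of "- 1"] bound[of \<i>] bound[of "- \<i>"] by simp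
  finally show ?thesis by simp
qed

lemma trace_bound:
  assumes "X \<in> M" "Y \<in> M"
  shows "cmod (\<tau> (X \<cdot> Y)) \<le> 2 * sqnorm2 X + 2 * sqnorm2 Y"
  using trace_adj_bound[of "adj X" Y] assms by (simp add: adj_adj bounded sqnorm2_adj)

lemma trace_nondegenerate:
  assumes Z: "Z \<in> M" and "\<And>Y. Y \<in> M \<Longrightarrow> \<tau> (Y \<cdot> Z) = 0"
  shows "Z = 0"
  using assms trace_faithful by blast

text \<open>
  Because \<open>I - R\<^sup>* R = (T R)\<^sup>* (T R)\<close> is positive.
\<close>

lemma resolvent_contraction:
  assumes R: "resolvent T R" and X: "X \<in> M"
  shows "sqnorm2 (R \<cdot> X) \<le> sqnorm2 X"
proof -
  note cl = resolvent_closed[OF R] and rs = resolvent_simps[OF R] and nrm = resolvent_normal(1)[OF R]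
  let ?Z = "T \<cdot> (R \<cdot> X)"
  have "adj ?Z \<cdot> ?Z + adj (R \<cdot> X) \<cdot> (R \<cdot> X)
      = adj X \<cdot> (adj R \<cdot> R + adj R \<cdot> R - R - adj R + id_blinfun) \<cdot> X"
    unfolding rs using cl X
    by (simp add: adj_compose adj_diff bounded operator_ring_simps)
  also have "\<dots> = adj X \<cdot> X" unfolding nrm by simp
  finally have "\<tau> (adj ?Z \<cdot> ?Z + adj (R \<cdot> X) \<cdot> (R \<cdot> X)) = \<tau> (adj X \<cdot> X)" by simp
  then have "\<tau> (adj ?Z \<cdot> ?Z) + \<tau> (adj (R \<cdot> X) \<cdot> (R \<cdot> X)) = \<tau> (adj X \<cdot> X)"
    using cl X by (subst (asm) trace_add) auto
  then have "sqnorm2 ?Z + sqnorm2 (R \<cdot> X) = sqnorm2 X"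
    by (simp add: sqnorm2_def complex_eq_iff)
  then show ?thesis using sqnorm2_nonneg[of ?Z] cl X by auto
qed

text \<open>
  As \<open>s\<close> tends to \<open>0\<close>, the resolvent \<open>R\<close> of \<open>i s H\<close> tends to the identity, so the vanishing of
  \<open>\<tau>(D R X R\<^sup>*)\<close> passes to the limit. The difference of the two sides is \<open>i s\<close> times a difference
  of traces, which cyclic permutation brings into the form \<open>\<tau>((R\<^sup>* D H) (R X))\<close> and
  \<open>\<tau>(R\<^sup>* (H D X))\<close>. These stay bounded because \<open>R\<close> and \<open>R\<^sup>*\<close> are contractions.
\<close>

lemma trace_resolvent_limit:
  assumes D: "D \<in> M" and X: "X \<in> M" and H: "H \<in> M" "adj H = H"
    and vanish: "\<And>s R. s > 0 \<Longrightarrow> resolvent ((\<i> * complex_of_real s) *\<^sub>C H) R \<Longrightarrow>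
      \<tau> (D \<cdot> (R \<cdot> X \<cdot> adj R)) = 0"
  shows "\<tau> (D \<cdot> X) = 0"
proof -
  define b where "b = 2 * sqnorm2 (D \<cdot> H) + 2 * sqnorm2 X + 2 + 2 * sqnorm2 (H \<cdot> (D \<cdot> X))"
  have est: "cmod (\<tau> (D \<cdot> X)) \<le> s * b" if s: "s > 0" "s * norm H < 1" for s
  proof -
    define c where "c = \<i> * complex_of_real s"
    obtain R where R: "resolvent (c *\<^sub>C H) R"
      using resolvent_exists[OF H, of s] s unfolding c_def by auto
    note cl = resolvent_closed(2)[OF R] and rs = resolvent_simps[OF R]
    have R': "resolvent (- (c *\<^sub>C H)) (adj R)" by (rule resolvent_adj[OF R])
    \<comment> \<open>Here \<open>R - I = T R\<close> and \<open>R\<^sup>* - I = - R\<^sup>* T\<close> are inserted into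
      \<open>D R X R\<^sup>* - D X = D (R - I) X R\<^sup>* + D X (R\<^sup>* - I)\<close>.\<close>
    have id: "D \<cdot> X = D \<cdot> (R \<cdot> X \<cdot> adj R) - c *\<^sub>C ((D \<cdot> H) \<cdot> (R \<cdot> X) \<cdot> adj R)
        + c *\<^sub>C ((D \<cdot> X) \<cdot> (adj R \<cdot> H))"
    proof -
      have "c *\<^sub>C ((D \<cdot> H) \<cdot> (R \<cdot> X) \<cdot> adj R) = D \<cdot> ((c *\<^sub>C H) \<cdot> (R \<cdot> (X \<cdot> adj R)))"
        using D H by (simp add: compose_assoc compose_scaleC_left compose_scaleC_right bounded)
      moreover have "c *\<^sub>C ((D \<cdot> X) \<cdot> (adj R \<cdot> H)) = D \<cdot> (X \<cdot> (adj R \<cdot> (c *\<^sub>C H)))"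
        using D X cl by (simp add: compose_assoc compose_scaleC_right bounded)
      ultimately show ?thesis unfolding rs by (simp add: operator_ring_simps)
    qed
    have "\<tau> (D \<cdot> X) = \<tau> (D \<cdot> (R \<cdot> X \<cdot> adj R)) - c * \<tau> ((D \<cdot> H) \<cdot> (R \<cdot> X) \<cdot> adj R)
        + c * \<tau> ((D \<cdot> X) \<cdot> (adj R \<cdot> H))"
      using D X H cl by (subst id) (simp add: trace_add trace_diff trace_scaleC)
    also have "\<tau> ((D \<cdot> H) \<cdot> (R \<cdot> X) \<cdot> adj R) = \<tau> ((adj R \<cdot> (D \<cdot> H)) \<cdot> (R \<cdot> X))"
      using trace_commute[of "D \<cdot> H \<cdot> (R \<cdot> X)" "adj R"] D X H cl by (simp add: compose_assoc)
    also have "\<tau> ((D \<cdot> X) \<cdot> (adj R \<cdot> H)) = \<tau> (adj R \<cdot> (H \<cdot> (D \<cdot> X)))"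
      using trace_commute[of "D \<cdot> X" "adj R \<cdot> H"] D X H cl by (simp add: compose_assoc)
    finally have split: "\<tau> (D \<cdot> X) = c * (\<tau> (adj R \<cdot> (H \<cdot> (D \<cdot> X))) - \<tau> ((adj R \<cdot> (D \<cdot> H)) \<cdot> (R \<cdot> X)))"
      using vanish[OF s(1)] R by (simp add: c_def algebra_simps)
    have "cmod (\<tau> (adj R \<cdot> (H \<cdot> (D \<cdot> X)))) \<le> 2 * sqnorm2 R + 2 * sqnorm2 (H \<cdot> (D \<cdot> X))"
      using trace_adj_bound D X H cl by auto
    moreover have "sqnorm2 R \<le> 1"
      using resolvent_contraction[OF R id_closed] by (simp add: sqnorm2_id)
    moreover have "cmod (\<tau> ((adj R \<cdot> (D \<cdot> H)) \<cdot> (R \<cdot> X))) \<le> 2 * sqnorm2 (adj R \<cdot> (D \<cdot> H)) + 2 * sqnorm2 (R \<cdot> X)"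
      using D X H cl by (intro trace_bound) auto
    moreover have "sqnorm2 (adj R \<cdot> (D \<cdot> H)) \<le> sqnorm2 (D \<cdot> H)" "sqnorm2 (R \<cdot> X) \<le> sqnorm2 X"
      using resolvent_contraction[OF R'] resolvent_contraction[OF R] D X H by auto
    ultimately have "cmod (\<tau> (adj R \<cdot> (H \<cdot> (D \<cdot> X))) - \<tau> ((adj R \<cdot> (D \<cdot> H)) \<cdot> (R \<cdot> X))) \<le> b"
      unfolding b_def by (intro norm_triangle_le_diff) linarith
    then show ?thesis using s unfolding split c_def by (simp add: norm_mult mult_left_mono)
  qed
  have b: "b > 0" unfolding b_def using sqnorm2_nonneg D X H
    by (smt (verit) compose_closed)
  show ?thesis
  proof (rule ccontr)
    assume "\<tau> (D \<cdot> X) \<noteq> 0"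
    \<comment> \<open>The first bound puts \<open>s\<close> into the range of \<open>est\<close>, the second makes \<open>s * b\<close> at most half of
      \<open>\<bar>\<tau>(D X)\<bar>\<close>.\<close>
    define s where "s = min (1 / (2 * (norm H + 1))) (cmod (\<tau> (D \<cdot> X)) / (2 * b))"
    have "norm H + 1 > 0" by (simp add: add_nonneg_pos)
    then have s0: "s > 0" using \<open>\<tau> (D \<cdot> X) \<noteq> 0\<close> b by (simp add: s_def)
    have "s * (2 * (norm H + 1)) \<le> 1"
      using \<open>norm H + 1 > 0\<close> by (subst pos_le_divide_eq[symmetric]) (auto simp: s_def)
    moreover have "0 \<le> s * norm H" using s0 by simp
    ultimately have "s * norm H < 1" using s0 by (simp add: algebra_simps)
    then have "cmod (\<tau> (D \<cdot> X)) \<le> s * b" using est s0 by blast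
    also have "\<dots> \<le> cmod (\<tau> (D \<cdot> X)) / (2 * b) * b"
      using b by (intro mult_right_mono) (auto simp: s_def)
    also have "\<dots> = cmod (\<tau> (D \<cdot> X)) / 2" using b by simp
    finally show False using \<open>\<tau> (D \<cdot> X) \<noteq> 0\<close> by simp
  qed
qed

end

section \<open>Primeness of factors\<close>

text \<open>
  The last property, uniqueness of the foot of the perpendicular, is what identifies values of the
  projection later.
\<close>

lemma orthogonal_projection:
  fixes K :: "'h::complex_hilbert_space set"
  assumes sub: "subspace K" and cl: "closed K" and scal: "\<And>c x. x \<in> K \<Longrightarrow> c *\<^sub>C x \<in> K"
  obtains E where "E \<in> bounded_operators" "\<And>x. blinfun_apply E x \<in> K"
    "\<And>x m. m \<in> K \<Longrightarrow> cinner (x - blinfun_apply E x) m = 0"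
    "\<And>x k. k \<in> K \<Longrightarrow> (\<And>m. m \<in> K \<Longrightarrow> cinner (x - k) m = 0) \<Longrightarrow> blinfun_apply E x = k"
proof -
  have "\<exists>k\<in>K. \<forall>m\<in>K. cinner (x - k) m = 0" for x
  proof -
    obtain k where k: "k \<in> K" "\<And>m. m \<in> K \<Longrightarrow> (x - k) \<bullet> m = 0"
      using closed_subspace_nearest_point_orthogonal[OF sub cl, of x] by blast
    then have "cinner (x - k) m = 0" if "m \<in> K" for m
      using that scal[OF that, of \<i>] by (simp add: cinner_eq_inner complex_eq_iff)
    then show ?thesis using k(1) by blast
  qed
  then obtain e where eK: "e x \<in> K" and orth: "m \<in> K \<Longrightarrow> cinner (x - e x) m = 0" for x m
    by metis
  have uniq: "e x = k" if k: "k \<in> K" and *: "\<And>m. m \<in> K \<Longrightarrow> cinner (x - k) m = 0" for x k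
  proof -
    have d: "e x - k \<in> K" using eK k sub by (simp add: subspace_diff)
    have "cinner (e x - k) (e x - k) = cinner (x - k) (e x - k) - cinner (x - e x) (e x - k)"
      by (simp add: cinner_simps)
    also have "\<dots> = 0" using *[OF d] orth[OF d] by simp
    finally have "inner (e x - k) (e x - k) = 0" by (simp only: inner_eq_Re_cinner zero_complex.sel)
    then show ?thesis by simp
  qed
  have lin: "bounded_linear e"
  proof (rule bounded_linear_intro[where K = 1])
    fix x y and r :: real
    show "e (x + y) = e x + e y"
    proof (rule uniq)
      show "e x + e y \<in> K" using eK sub by (simp add: subspace_add)
      fix m assume "m \<in> K"
      then have "cinner ((x - e x) + (y - e y)) m = 0" by (simp only: cinner_add_left orth) simp
      then show "cinner (x + y - (e x + e y)) m = 0" by (simp add: algebra_simps)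
    qed
    show "e (r *\<^sub>R x) = r *\<^sub>R e x"
    proof (rule uniq)
      show "r *\<^sub>R e x \<in> K" using eK sub by (simp add: subspace_scale)
      fix m assume "m \<in> K"
      then have "cinner (complex_of_real r *\<^sub>C (x - e x)) m = 0" by (simp add: cinner_scaleC_left orth)
      then show "cinner (r *\<^sub>R x - r *\<^sub>R e x) m = 0"
        by (simp flip: scaleR_eq_scaleC add: scaleR_right_diff_distrib)
    qed
    have "Re (cinner (x - e x) (e x)) = 0" using orth[OF eK] by simp
    then have "norm (e x) * norm (e x) = x \<bullet> e x"
      by (simp add: inner_diff_left power2_norm_eq_inner flip: inner_eq_Re_cinner power2_eq_square)
    also have "\<dots> \<le> norm x * norm (e x)" by (rule norm_cauchy_schwarz)
    finally show "norm (e x) \<le> norm x * 1" by (cases "norm (e x) = 0") auto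
  qed
  have E: "blinfun_apply (Blinfun e) = e" by (rule bounded_linear_Blinfun_apply[OF lin])
  have "e (c *\<^sub>C x) = c *\<^sub>C e x" for c x
  proof (rule uniq)
    show "c *\<^sub>C e x \<in> K" using eK scal by simp
    fix m assume "m \<in> K"
    then have "cinner (c *\<^sub>C (x - e x)) m = 0" by (simp add: cinner_scaleC_left orth)
    then show "cinner (c *\<^sub>C x - c *\<^sub>C e x) m = 0"
      by (simp add: cinner_simps cinner_scaleC_left algebra_simps)
  qed
  then have "Blinfun e \<in> bounded_operators" by (simp add: bounded_operators_def E)
  then show ?thesis
    by (rule that) (simp_all add: E eK orth uniq)
qed

lemma subspace_closure:
  fixes S :: "'a::real_normed_vector set"
  assumes S: "subspace S"
  shows "subspace (closure S)"
  unfolding subspace_def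
proof (intro conjI ballI allI)
  show "0 \<in> closure S" using subspace_0[OF S] closure_subset by blast
  fix x assume "x \<in> closure S"
  then obtain f where f: "\<And>n. f n \<in> S" "f \<longlonglongrightarrow> x" by (auto simp: closure_sequential)
  show "x + y \<in> closure S" if y: "y \<in> closure S" for y
  proof -
    obtain g where g: "\<And>n. g n \<in> S" "g \<longlonglongrightarrow> y" using y by (auto simp: closure_sequential)
    have "(\<lambda>n. f n + g n) \<longlonglongrightarrow> x + y" by (intro tendsto_add f g)
    moreover have "\<And>n. f n + g n \<in> S" using f g S by (simp add: subspace_add)
    ultimately show ?thesis
      unfolding closure_sequential by (intro exI[of _ "\<lambda>n. f n + g n"]) simp
  qed
  show "c *\<^sub>R x \<in> closure S" for c
  proof -
    have "(\<lambda>n. c *\<^sub>R f n) \<longlonglongrightarrow> c *\<^sub>R x" by (intro tendsto_scaleR tendsto_const f)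
    moreover have "\<And>n. c *\<^sub>R f n \<in> S" using f S by (simp add: subspace_scale)
    ultimately show ?thesis
      unfolding closure_sequential by (intro exI[of _ "\<lambda>n. c *\<^sub>R f n"]) simp
  qed
qed

lemma closure_span_invariant:
  fixes f :: "'a::real_normed_vector \<Rightarrow> 'a"
  assumes f: "bounded_linear f" and G: "\<And>g. g \<in> G \<Longrightarrow> f g \<in> closure (span G)"
    and x: "x \<in> closure (span G)"
  shows "f x \<in> closure (span G)"
proof -
  have "f ` span G = span (f ` G)"
    using linear_span_image[OF bounded_linear.linear[OF f]] by simp
  also have "\<dots> \<subseteq> closure (span G)"
    using G by (intro span_minimal subspace_closure) auto
  finally have "f ` closure (span G) \<subseteq> closure (span G)"
    by (intro image_closure_subset closed_closure linear_continuous_on f)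
  then show ?thesis using x by blast
qed

context von_neumann
begin

text \<open>
  The closed subspace \<open>K\<close> spanned by the ranges of all \<open>Y Q\<close> with \<open>Y \<in> M\<close> is invariant under \<open>M\<close> and
  under its commutant, and both are closed under adjoints. So the projection onto \<open>K\<close> lies in the
  double commutant and in the commutant of \<open>M\<close>, hence in the centre, and is a scalar. It fixes a
  nonzero vector if \<open>Q \<noteq> 0\<close>; then \<open>K\<close> is the whole space, on which \<open>P\<close> vanishes.
\<close>

lemma factor_prime:
  assumes fac: "factor M" and PQ: "P \<in> M" "Q \<in> M"
    and zero: "\<And>Y. Y \<in> M \<Longrightarrow> P \<cdot> Y \<cdot> Q = 0"
  shows "P = 0 \<or> Q = 0"
proof (rule disjCI)
  assume "Q \<noteq> 0"
  then obtain h where h: "blinfun_apply Q h \<noteq> 0"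
    by (metis blinfun_eqI zero_blinfun.rep_eq)
  define G where "G = {blinfun_apply (Y \<cdot> Q) v | Y v. Y \<in> M}"
  define K where "K = closure (span G)"
  have GK: "g \<in> K" if "g \<in> G" for g
    using that closure_subset span_base unfolding K_def by blast
  have G_invariant: "blinfun_apply B k \<in> K"
    if B: "\<And>g. g \<in> G \<Longrightarrow> blinfun_apply B g \<in> G" and "k \<in> K" for B k
    using closure_span_invariant[OF blinfun.bounded_linear_right[of B], of G k] B GK \<open>k \<in> K\<close>
    unfolding K_def by blast
  have M_inv: "blinfun_apply B k \<in> K" if B: "B \<in> M" and k: "k \<in> K" for B k
  proof (rule G_invariant[OF _ k])
    fix g assume "g \<in> G"
    then obtain Y v where "Y \<in> M" "g = blinfun_apply (Y \<cdot> Q) v" by (auto simp: G_def)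
    then have "blinfun_apply B g = blinfun_apply ((B \<cdot> Y) \<cdot> Q) v" "B \<cdot> Y \<in> M" using B by auto
    then show "blinfun_apply B g \<in> G" by (auto simp only: G_def)
  qed
  have M'_inv: "blinfun_apply B k \<in> K" if B: "B \<in> commutant M" and k: "k \<in> K" for B k
  proof (rule G_invariant[OF _ k])
    fix g assume "g \<in> G"
    then obtain Y v where Y: "Y \<in> M" "g = blinfun_apply (Y \<cdot> Q) v" by (auto simp: G_def)
    then have "B \<cdot> (Y \<cdot> Q) = (Y \<cdot> Q) \<cdot> B" using commutant_commutes[OF B, of "Y \<cdot> Q"] PQ by simp
    then have "blinfun_apply B g = blinfun_apply (Y \<cdot> Q) (blinfun_apply B v)"
      using Y(2) by (metis blinfun_apply_blinfun_compose)
    then show "blinfun_apply B g \<in> G" using Y(1) by (auto simp only: G_def)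
  qed
  have sub: "subspace K" and cl: "closed K"
    by (auto simp: K_def intro: subspace_closure)
  have "c *\<^sub>C x \<in> K" if "x \<in> K" for c x
    using M_inv[of "c *\<^sub>C id_blinfun" x] that by auto
  then obtain E where E: "E \<in> bounded_operators" and EK: "\<And>x. blinfun_apply E x \<in> K"
    and orth: "\<And>x m. m \<in> K \<Longrightarrow> cinner (x - blinfun_apply E x) m = 0"
    and uniq: "\<And>x k. k \<in> K \<Longrightarrow> (\<And>m. m \<in> K \<Longrightarrow> cinner (x - k) m = 0) \<Longrightarrow> blinfun_apply E x = k"
    using orthogonal_projection[OF sub cl] by metis
  have E_commutes: "B \<cdot> E = E \<cdot> B"
    if B: "B \<in> bounded_operators" and inv: "\<And>k. k \<in> K \<Longrightarrow> blinfun_apply B k \<in> K"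
      "\<And>k. k \<in> K \<Longrightarrow> blinfun_apply (adj B) k \<in> K" for B
  proof (rule blinfun_eqI)
    fix x
    have "blinfun_apply E (blinfun_apply B x) = blinfun_apply B (blinfun_apply E x)"
    proof (rule uniq)
      show "blinfun_apply B (blinfun_apply E x) \<in> K" using EK inv(1) by blast
      fix m assume "m \<in> K"
      then have "cinner (blinfun_apply B (x - blinfun_apply E x)) m = 0"
        using inv(2) by (simp only: cinner_adj[OF B] orth)
      then show "cinner (blinfun_apply B x - blinfun_apply B (blinfun_apply E x)) m = 0"
        by (simp add: blinfun.diff_right)
    qed
    then show "blinfun_apply (B \<cdot> E) x = blinfun_apply (E \<cdot> B) x" by simp
  qed
  have "E \<in> M"
    by (rule bicommutant_mem[OF E], rule E_commutes)
      (use commutant_bounded M'_inv commutant_adj_closed in blast)+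
  moreover have "E \<in> commutant M"
    unfolding commutant_def using E E_commutes bounded M_inv adj_closed by blast
  ultimately have "E \<in> scalar_operators" using fac by (auto simp: factor_def)
  then obtain c where c: "E = c *\<^sub>C id_blinfun" by (auto simp: scalar_operators_def)
  have "blinfun_apply Q h = blinfun_apply (id_blinfun \<cdot> Q) h" by simp
  then have QK: "blinfun_apply Q h \<in> K" using GK unfolding G_def by blast
  have "blinfun_apply E (blinfun_apply Q h) = blinfun_apply Q h"
    by (rule uniq[OF QK]) (simp add: cinner_simps)
  then have "norm ((c - 1) *\<^sub>C blinfun_apply Q h) = 0"
    using scaleC_add_left[of "c - 1" 1 "blinfun_apply Q h"] by (simp add: c)
  then have "c = 1" using h by (simp add: norm_scaleC)
  then have all: "x \<in> K" for x using EK[of x] by (simp add: c)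
  have "subspace {x. blinfun_apply P x = 0}"
    by (auto simp: subspace_def blinfun.bilinear_simps)
  moreover have "G \<subseteq> {x. blinfun_apply P x = 0}"
  proof
    fix g assume "g \<in> G"
    then obtain Y v where Y: "Y \<in> M" "g = blinfun_apply (Y \<cdot> Q) v" by (auto simp: G_def)
    have "blinfun_apply P g = blinfun_apply (P \<cdot> Y \<cdot> Q) v" by (simp add: Y(2))
    then show "g \<in> {x. blinfun_apply P x = 0}" by (simp add: zero[OF Y(1)])
  qed
  ultimately have "span G \<subseteq> {x. blinfun_apply P x = 0}" by (rule span_minimal[rotated])
  moreover have "closed {x. blinfun_apply P x = 0}"
    by (intro closed_Collect_eq continuous_intros)
  ultimately have "K \<subseteq> {x. blinfun_apply P x = 0}" unfolding K_def by (rule closure_minimal)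
  then show "P = 0" using all by (intro blinfun_eqI) auto
qed

section \<open>Commuting derivations\<close>

definition derivation :: "('h \<Rightarrow>\<^sub>L 'h) \<Rightarrow> ('h \<Rightarrow>\<^sub>L 'h) \<Rightarrow> ('h \<Rightarrow>\<^sub>L 'h)" where
  "derivation A X = X \<cdot> A - A \<cdot> X"

lemma derivation_closed [simp, intro]: "A \<in> M \<Longrightarrow> X \<in> M \<Longrightarrow> derivation A X \<in> M"
  by (auto simp: derivation_def)

lemma derivation_compose: "derivation A (X \<cdot> Y) = derivation A X \<cdot> Y + X \<cdot> derivation A Y"
  by (simp add: derivation_def operator_ring_simps)

lemma derivation_add: "derivation A (X + Y) = derivation A X + derivation A Y"
  by (simp add: derivation_def operator_ring_simps)

lemma scalar_iff_derivation_zero: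
  assumes "factor M" "A \<in> M"
  shows "A \<in> scalar_operators \<longleftrightarrow> (\<forall>X\<in>M. derivation A X = 0)"
proof -
  have "A \<in> commutant M \<longleftrightarrow> (\<forall>X\<in>M. derivation A X = 0)"
    using assms(2) by (auto simp: commutant_def derivation_def bounded)
  then show ?thesis using assms by (auto simp: factor_def)
qed

text \<open>
  Expanding the composite of the derivations \<open>a(X) = [X, A]\<close> and \<open>c(X) = [X, C]\<close> on a product gives
  \<open>a(X) c(Y) + c(X) a(Y) = 0\<close>, and replacing \<open>Y\<close> by \<open>Y Z\<close> gives \<open>a(X) Y c(Z) + c(X) Y a(Z) = 0\<close>.
  Fix \<open>X\<close> with \<open>c(X) \<noteq> 0\<close>. For \<open>Z = X\<close> the last identity says that \<open>a(X)\<close> and \<open>c(X)\<close> can be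
  exchanged in any product at the cost of a sign, and primeness forces \<open>a(X) = 0\<close>. What remains is
  \<open>c(X) Y a(Z) = 0\<close> for all \<open>Y\<close> and \<open>Z\<close>, so \<open>a = 0\<close> by primeness again.
\<close>

lemma derivations_compose_zero_imp_scalar:
  assumes fac: "factor M" and A: "A \<in> M" and C: "C \<in> M"
    and zero: "\<And>X. X \<in> M \<Longrightarrow> derivation C (derivation A X) = 0"
    and nonscalar: "C \<notin> scalar_operators"
  shows "A \<in> scalar_operators"
proof -
  let ?a = "derivation A" and ?c = "derivation C"
  have two: "?a X \<cdot> ?c Y + ?c X \<cdot> ?a Y = 0" if "X \<in> M" "Y \<in> M" for X Y
  proof -
    have "?c (?a (X \<cdot> Y)) = ?c (?a X) \<cdot> Y + (?a X \<cdot> ?c Y + ?c X \<cdot> ?a Y) + X \<cdot> ?c (?a Y)"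
      by (simp add: derivation_compose derivation_add add_ac)
    then show ?thesis using zero that by simp
  qed
  have three: "?a X \<cdot> Y \<cdot> ?c Z + ?c X \<cdot> Y \<cdot> ?a Z = 0" if "X \<in> M" "Y \<in> M" "Z \<in> M" for X Y Z
  proof -
    have "?a X \<cdot> ?c (Y \<cdot> Z) + ?c X \<cdot> ?a (Y \<cdot> Z)
        = (?a X \<cdot> ?c Y + ?c X \<cdot> ?a Y) \<cdot> Z + (?a X \<cdot> Y \<cdot> ?c Z + ?c X \<cdot> Y \<cdot> ?a Z)"
      by (simp add: derivation_compose compose_distribs compose_assoc add_ac)
    then show ?thesis using two that by simp
  qed
  obtain X where X: "X \<in> M" "?c X \<noteq> 0"
    using nonscalar scalar_iff_derivation_zero[OF fac C] by blast
  have PP: "?a X \<cdot> Y \<cdot> ?a X = 0" if Y: "Y \<in> M" for Y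
  proof -
    have swap: "?a X \<cdot> W \<cdot> ?c X = - (?c X \<cdot> W \<cdot> ?a X)" if "W \<in> M" for W
      using three[of X W X] X that by (simp add: eq_neg_iff_add_eq_0)
    have "?a X \<cdot> Y \<cdot> ?a X \<cdot> W \<cdot> ?c X = 0" if W: "W \<in> M" for W
    proof -
      \<comment> \<open>Two adjacent exchanges lead from the pattern \<open>a a c\<close> to \<open>c a a\<close> with sign \<open>+\<close>, one exchange of
        the outer factors leads back with sign \<open>-\<close>.\<close>
      let ?t = "?a X \<cdot> Y \<cdot> ?a X \<cdot> W \<cdot> ?c X"
      have "?t = (?a X \<cdot> Y) \<cdot> (?a X \<cdot> W \<cdot> ?c X)" by (simp add: compose_assoc)
      also have "\<dots> = - ((?a X \<cdot> Y \<cdot> ?c X) \<cdot> (W \<cdot> ?a X))"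
        unfolding swap[OF W] by (simp add: compose_distribs compose_assoc)
      also have "\<dots> = ?c X \<cdot> (Y \<cdot> ?a X \<cdot> W) \<cdot> ?a X"
        unfolding swap[OF Y] by (simp add: compose_distribs compose_assoc)
      also have "\<dots> = - (?a X \<cdot> (Y \<cdot> ?a X \<cdot> W) \<cdot> ?c X)"
        using swap[of "Y \<cdot> ?a X \<cdot> W"] Y W X A by simp
      finally have "?t = - ?t" by (simp add: compose_assoc)
      then have "2 *\<^sub>R ?t = 0" by (metis scaleR_2 add.right_inverse)
      then show ?thesis by simp
    qed
    then have "?a X \<cdot> Y \<cdot> ?a X = 0 \<or> ?c X = 0"
      using X A C Y by (intro factor_prime[OF fac]) auto
    then show ?thesis using X by blast
  qed
  have aX: "?a X = 0"
    using factor_prime[OF fac _ _ PP] X A by auto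
  have "?a Z = 0" if Z: "Z \<in> M" for Z
  proof -
    have "?c X \<cdot> Y \<cdot> ?a Z = 0" if "Y \<in> M" for Y using three[OF X(1) that Z] by (simp add: aX)
    then have "?c X = 0 \<or> ?a Z = 0" using X Z A C by (intro factor_prime[OF fac]) auto
    then show ?thesis using X by blast
  qed
  then show ?thesis using scalar_iff_derivation_zero[OF fac A] by blast
qed

end

section \<open>Orthogonality to a unitary orbit\<close>

context tracial_von_neumann
begin

definition orbit_orthogonal :: "('h \<Rightarrow>\<^sub>L 'h) \<Rightarrow> ('h \<Rightarrow>\<^sub>L 'h) \<Rightarrow> bool" where
  "orbit_orthogonal C A \<longleftrightarrow> A \<in> M \<and> (\<forall>U\<in>unitaries M. \<tau> (C \<cdot> (U \<cdot> A \<cdot> adj U)) = 0)"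

lemma orbit_orthogonal_conj:
  assumes A: "orbit_orthogonal C A" and U: "U \<in> unitaries M"
  shows "orbit_orthogonal C (U \<cdot> A \<cdot> adj U)"
proof -
  have "V \<cdot> (U \<cdot> A \<cdot> adj U) \<cdot> adj V = (V \<cdot> U) \<cdot> A \<cdot> adj (V \<cdot> U)" if "V \<in> unitaries M" for V
    using that U unitaries_mem by (simp add: adj_compose bounded compose_assoc)
  then show ?thesis using assms unitaries_mem[OF U] unfolding orbit_orthogonal_def by auto
qed

text \<open>
  The derivative at the identity of \<open>\<tau>(C U A U\<^sup>*) = 0\<close> along the Cayley transforms of \<open>i s H\<close>.
\<close>

lemma trace_derivation_selfadjoint:
  assumes C: "C \<in> M" and A: "orbit_orthogonal C A" and H: "H \<in> M" "adj H = H"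
  shows "\<tau> (C \<cdot> derivation A H) = 0"
proof (rule trace_resolvent_limit[OF C _ H])
  have AM: "A \<in> M" using A by (simp add: orbit_orthogonal_def)
  show "derivation A H \<in> M" using AM H by auto
  fix s :: real and R
  assume s: "s > 0"
  define c where "c = \<i> * complex_of_real s"
  assume "resolvent ((\<i> * complex_of_real s) *\<^sub>C H) R"
  then have R: "resolvent (c *\<^sub>C H) R" by (simp add: c_def)
  have RM: "R \<in> M" by (rule resolvent_closed(2)[OF R])
  let ?U = "R + R - id_blinfun" and ?Y = "R \<cdot> derivation A H \<cdot> adj R"
  have "(c *\<^sub>C H) \<cdot> A - A \<cdot> (c *\<^sub>C H) = c *\<^sub>C derivation A H"
    using AM by (simp add: derivation_def compose_scaleC_left compose_scaleC_right bounded
        blinfun_scaleC_simps)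
  then have conj: "?U \<cdot> A \<cdot> adj ?U = A + 2 *\<^sub>R (c *\<^sub>C ?Y)"
    using cayley_unitary(2)[OF R, of A] RM
    by (simp add: compose_scaleC_left compose_scaleC_right bounded)
  have "0 = \<tau> (C \<cdot> (?U \<cdot> A \<cdot> adj ?U))"
    using A cayley_unitary(1)[OF R] by (simp add: orbit_orthogonal_def)
  also have "C \<cdot> (?U \<cdot> A \<cdot> adj ?U) = C \<cdot> A + (c *\<^sub>C (C \<cdot> ?Y) + c *\<^sub>C (C \<cdot> ?Y))"
    unfolding conj scaleR_2 using C by (simp add: compose_distribs compose_scaleC_right bounded)
  also have "\<tau> \<dots> = \<tau> (C \<cdot> A) + 2 * (c * \<tau> (C \<cdot> ?Y))"
    using C AM H RM by (simp add: trace_add trace_scaleC)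
  also have "\<tau> (C \<cdot> A) = 0"
    using A unitaries_id unfolding orbit_orthogonal_def by fastforce
  finally show "\<tau> (C \<cdot> ?Y) = 0" using s by (simp add: c_def)
qed

lemma trace_derivation_zero:
  assumes C: "C \<in> M" and A: "orbit_orthogonal C A" and X: "X \<in> M"
  shows "\<tau> (C \<cdot> derivation A X) = 0"
proof -
  obtain H K where HK: "H \<in> M" "adj H = H" "K \<in> M" "adj K = K" "X = H + \<i> *\<^sub>C K"
    using real_imaginary_parts[OF X] .
  have AM: "A \<in> M" using A by (simp add: orbit_orthogonal_def)
  have "derivation A X = derivation A H + \<i> *\<^sub>C derivation A K"
    unfolding HK(5) derivation_add using AM
    by (simp add: derivation_def compose_scaleC_left compose_scaleC_right bounded blinfun_scaleC_simps)
  then have "\<tau> (C \<cdot> derivation A X) = \<tau> (C \<cdot> derivation A H) + \<i> * \<tau> (C \<cdot> derivation A K)"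
    using C AM HK(1,3)
    by (simp add: compose_distribs compose_scaleC_right bounded trace_add trace_scaleC)
  then show ?thesis using trace_derivation_selfadjoint[OF C A] HK by simp
qed

text \<open>
  Conjugation by \<open>U\<close> turns \<open>[X, A]\<close> into the commutator of the conjugates, so the vanishing of
  \<open>\<tau>(C [X, A])\<close> extends to its whole unitary orbit.
\<close>

lemma orbit_orthogonal_derivation:
  assumes C: "C \<in> M" and A: "orbit_orthogonal C A" and X: "X \<in> M"
  shows "orbit_orthogonal C (derivation A X)"
  unfolding orbit_orthogonal_def
proof (intro conjI ballI)
  show "derivation A X \<in> M" using A X by (auto simp: orbit_orthogonal_def)
  fix U assume U: "U \<in> unitaries M"
  have "U \<cdot> derivation A X \<cdot> adj U = derivation (U \<cdot> A \<cdot> adj U) (U \<cdot> X \<cdot> adj U)"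
    using U by (simp add: derivation_def operator_ring_simps)
  then show "\<tau> (C \<cdot> (U \<cdot> derivation A X \<cdot> adj U)) = 0"
    using trace_derivation_zero[OF C orbit_orthogonal_conj[OF A U]] X unitaries_mem[OF U] by simp
qed

text \<open>
  Cyclic permutation moves the commutator, \<open>\<tau>(C [Y, A]) = \<tau>(Y [A, C])\<close>, and the trace form is
  nondegenerate.
\<close>

lemma orbit_orthogonal_commutes:
  assumes C: "C \<in> M" and A: "orbit_orthogonal C A"
  shows "derivation C A = 0"
proof (rule trace_nondegenerate)
  have AM: "A \<in> M" using A by (simp add: orbit_orthogonal_def)
  show "derivation C A \<in> M" using C AM by auto
  fix Y assume Y: "Y \<in> M"
  have "\<tau> (C \<cdot> derivation A Y) = \<tau> (C \<cdot> (Y \<cdot> A)) - \<tau> ((C \<cdot> A) \<cdot> Y)"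
    using C AM Y by (simp add: derivation_def compose_distribs trace_diff compose_assoc)
  also have "\<dots> = \<tau> ((Y \<cdot> A) \<cdot> C) - \<tau> (Y \<cdot> (C \<cdot> A))"
    using trace_commute[of C "Y \<cdot> A"] trace_commute[of "C \<cdot> A" Y] C AM Y by simp
  also have "\<dots> = \<tau> (Y \<cdot> derivation C A)"
    using C AM Y by (simp add: derivation_def compose_distribs trace_diff compose_assoc)
  finally show "\<tau> (Y \<cdot> derivation C A) = 0" using trace_derivation_zero[OF C A Y] by simp
qed

lemma orbit_orthogonal_imp_scalar:
  assumes "factor M" and C: "C \<in> M" "C \<notin> scalar_operators" and A: "orbit_orthogonal C A"
  shows "A \<in> scalar_operators"
  using derivations_compose_zero_imp_scalar[OF assms(1) _ C(1) _ C(2)]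
    orbit_orthogonal_commutes[OF C(1) orbit_orthogonal_derivation[OF C(1) A]] A
  by (auto simp: orbit_orthogonal_def)

section \<open>The C-numerical radius\<close>

abbreviation radius :: "('h \<Rightarrow>\<^sub>L 'h) \<Rightarrow> ('h \<Rightarrow>\<^sub>L 'h) \<Rightarrow> real" where
  "radius \<equiv> C_numerical_radius M \<tau>"

lemma radius_eq: "radius C A = (SUP U\<in>unitaries M. cmod (\<tau> (C \<cdot> (U \<cdot> A \<cdot> adj U))))"
  by (simp add: C_numerical_radius_def compose_assoc)

lemma radius_upper:
  assumes C: "C \<in> M" and A: "A \<in> M" and U: "U \<in> unitaries M"
  shows "cmod (\<tau> (C \<cdot> (U \<cdot> A \<cdot> adj U))) \<le> radius C A"
  unfolding radius_eq
proof (rule cSUP_upper[OF U bdd_aboveI2])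
  fix V assume V: "V \<in> unitaries M"
  show "cmod (\<tau> (C \<cdot> (V \<cdot> A \<cdot> adj V))) \<le> 2 * sqnorm2 C + 2 * sqnorm2 A"
    using trace_bound[of C "V \<cdot> A \<cdot> adj V"] sqnorm2_unitary_conj[OF V A] C A unitaries_mem[OF V]
    by simp
qed

lemma radius_least:
  assumes "\<And>U. U \<in> unitaries M \<Longrightarrow> cmod (\<tau> (C \<cdot> (U \<cdot> A \<cdot> adj U))) \<le> b"
  shows "radius C A \<le> b"
  unfolding radius_eq by (rule cSUP_least) (use assms unitaries_id in blast)+

lemma radius_nonneg: "C \<in> M \<Longrightarrow> A \<in> M \<Longrightarrow> 0 \<le> radius C A"
  using radius_upper[OF _ _ unitaries_id] norm_ge_zero order_trans by blast

lemma radius_eq_0_iff: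
  assumes "C \<in> M" "A \<in> M"
  shows "radius C A = 0 \<longleftrightarrow> orbit_orthogonal C A"
proof
  assume "radius C A = 0"
  then show "orbit_orthogonal C A"
    using radius_upper[OF assms] assms(2) unfolding orbit_orthogonal_def by fastforce
next
  assume "orbit_orthogonal C A"
  then have "radius C A \<le> 0"
    by (intro radius_least) (simp add: orbit_orthogonal_def)
  then show "radius C A = 0" using radius_nonneg[OF assms] by simp
qed

lemma radius_triangle:
  assumes C: "C \<in> M" and AB: "A \<in> M" "B \<in> M"
  shows "radius C (A + B) \<le> radius C A + radius C B"
proof (rule radius_least)
  fix U assume U: "U \<in> unitaries M"
  have "\<tau> (C \<cdot> (U \<cdot> (A + B) \<cdot> adj U))
      = \<tau> (C \<cdot> (U \<cdot> A \<cdot> adj U)) + \<tau> (C \<cdot> (U \<cdot> B \<cdot> adj U))"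
    using C AB unitaries_mem[OF U] by (simp add: compose_distribs trace_add)
  then show "cmod (\<tau> (C \<cdot> (U \<cdot> (A + B) \<cdot> adj U))) \<le> radius C A + radius C B"
    using norm_triangle_mono[OF radius_upper[OF C AB(1) U] radius_upper[OF C AB(2) U]] by simp
qed

lemma radius_scaleC:
  assumes C: "C \<in> M" and A: "A \<in> M"
  shows "radius C (c *\<^sub>C A) = cmod c * radius C A"
proof (rule antisym)
  \<comment> \<open>Scaling back by the inverse scalar turns this inequality into the reverse one.\<close>
  have le: "radius C (a *\<^sub>C B) \<le> cmod a * radius C B" if B: "B \<in> M" for a B
  proof (rule radius_least)
    fix U assume U: "U \<in> unitaries M"
    have "\<tau> (C \<cdot> (U \<cdot> (a *\<^sub>C B) \<cdot> adj U)) = a * \<tau> (C \<cdot> (U \<cdot> B \<cdot> adj U))"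
      using C B unitaries_mem[OF U]
      by (simp add: compose_scaleC_left compose_scaleC_right bounded trace_scaleC)
    then show "cmod (\<tau> (C \<cdot> (U \<cdot> (a *\<^sub>C B) \<cdot> adj U))) \<le> cmod a * radius C B"
      using radius_upper[OF C B U] by (simp add: norm_mult mult_left_mono)
  qed
  show "radius C (c *\<^sub>C A) \<le> cmod c * radius C A" by (rule le[OF A])
  show "cmod c * radius C A \<le> radius C (c *\<^sub>C A)"
  proof (cases "c = 0")
    case False
    have "radius C A = radius C (inverse c *\<^sub>C c *\<^sub>C A)"
      using False by (simp add: blinfun_scaleC_simps)
    also have "\<dots> \<le> cmod (inverse c) * radius C (c *\<^sub>C A)" using A by (intro le) auto
    finally show ?thesis using False by (simp add: norm_inverse norm_divide field_simps)
  qed (use radius_nonneg C A in \<open>auto simp: blinfun_scaleC_simps\<close>)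
qed

lemma norm_on_radius_iff:
  assumes C: "C \<in> M"
  shows "norm_on M (radius C) \<longleftrightarrow> (\<forall>A. orbit_orthogonal C A \<longrightarrow> A = 0)"
proof -
  have "orbit_orthogonal C 0" using C by (simp add: orbit_orthogonal_def)
  then show ?thesis
    unfolding norm_on_def
    using radius_nonneg[OF C] radius_eq_0_iff[OF C] radius_scaleC[OF C] radius_triangle[OF C]
    by (auto simp: orbit_orthogonal_def)
qed

end

theorem corollary1p3:
  fixes M :: "('h::complex_hilbert_space \<Rightarrow>\<^sub>L 'h) set"
    and \<tau> :: "('h \<Rightarrow>\<^sub>L 'h) \<Rightarrow> complex"
    and C :: "'h \<Rightarrow>\<^sub>L 'h"
  assumes "finite_factor M"
    and "separable_predual M"
    and "M \<noteq> scalar_operators"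
    and "faithful_normal_tracial_state M \<tau>"
    and "C \<in> M"
  shows "norm_on M (C_numerical_radius M \<tau> C) \<longleftrightarrow>
    C \<notin> scalar_operators \<and> \<tau> C \<noteq> 0"
proof -
  have fac: "factor M" using assms(1) by (simp add: finite_factor_def)
  interpret tracial_von_neumann M \<tau>
    using fac assms(4) by unfold_locales (simp_all add: factor_def)
  have C: "C \<in> M" by fact
  show ?thesis
    unfolding norm_on_radius_iff[OF C]
  proof (intro iffI conjI allI impI notI)
    assume definite: "\<forall>A. orbit_orthogonal C A \<longrightarrow> A = 0"
    show False if scalar: "C \<in> scalar_operators"
    proof -
      obtain c where c: "C = c *\<^sub>C id_blinfun" using scalar unfolding scalar_operators_def by blast
      have "scalar_operators \<subseteq> M" by (auto simp: scalar_operators_def)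
      then obtain B where B: "B \<in> M" "B \<notin> scalar_operators" using assms(3) by blast
      let ?A = "B - \<tau> B *\<^sub>C id_blinfun"
      have A: "?A \<in> M" "\<tau> ?A = 0" using B by (auto simp: trace_diff trace_scaleC trace_id)
      have "\<tau> (C \<cdot> (U \<cdot> ?A \<cdot> adj U)) = 0" if U: "U \<in> unitaries M" for U
      proof -
        note UM = unitaries_mem[OF U]
        have "\<tau> (C \<cdot> (U \<cdot> ?A \<cdot> adj U)) = c * \<tau> ((U \<cdot> ?A) \<cdot> adj U)"
          using UM A(1) by (simp add: c compose_scaleC_left trace_scaleC)
        also have "\<tau> ((U \<cdot> ?A) \<cdot> adj U) = \<tau> (adj U \<cdot> (U \<cdot> ?A))"
          using UM A(1) by (intro trace_commute) auto
        also have "\<dots> = 0" using A(2) by (simp only: unitary_adj_cancel(3)[OF U])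
        finally show ?thesis by simp
      qed
      then have "?A = 0" using definite A(1) unfolding orbit_orthogonal_def by blast
      then have "B = \<tau> B *\<^sub>C id_blinfun" by simp
      then show False using B(2) unfolding scalar_operators_def by blast
    qed
    show False if "\<tau> C = 0"
    proof -
      have "orbit_orthogonal C id_blinfun" using that by (simp add: orbit_orthogonal_def)
      then have "id_blinfun = (0 :: 'h \<Rightarrow>\<^sub>L 'h)" using definite by blast
      then show False using trace_id by simp
    qed
  next
    fix A assume "C \<notin> scalar_operators \<and> \<tau> C \<noteq> 0" and A: "orbit_orthogonal C A"
    then have "A \<in> scalar_operators" using orbit_orthogonal_imp_scalar[OF fac C] by blast
    then obtain c where c: "A = c *\<^sub>C id_blinfun" unfolding scalar_operators_def by blast
    have "\<tau> (C \<cdot> A) = 0"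
      using A unitaries_id unfolding orbit_orthogonal_def by fastforce
    then have "c * \<tau> C = 0" using C by (simp add: c compose_scaleC_right bounded trace_scaleC)
    then show "A = 0" using \<open>C \<notin> scalar_operators \<and> \<tau> C \<noteq> 0\<close> by (simp add: c blinfun_scaleC_simps)
  qed
qed

end
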